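(* For all small contextual categories $\mathcal A,\mathcal B$, the isomorphisms $\beta_{\mathcal A,\mathcal B}:\mathcal A\otimes\mathcal B\to\mathcal B\otimes\mathcal A$ and $\beta_{\mathcal B,\mathcal A}:\mathcal B\otimes\mathcal A\to\mathcal A\otimes\mathcal B$ are inverses of each other.
   Context: A precontextual category $\mathcal C$ consists of: a category $|\mathcal C|$ (with a set of objects); a length function $\ell$ from objects to $\mathbb N$; a function $\partial$ from objects to objects with $\ell(\partial a)=\ell(a)-1$ if $\ell(a)\ge 1$ and $\partial a=a$ if $\ell(a)=0$; for each object $a$ with $\ell(a)\ge1$ a morphism $\mathbf p_a:a\to\partial a$; and a set $\mathbf Q$ of commutative squares in $|\mathcal C|$ having left side some $\mathbf p_a$ and right side some $\mathbf p_b$. A display map (written $\twoheadrightarrow$) is a finite, possibly empty, composite of maps $\mathbf p_a$; its length is $\ell(\text{domain})-\ell(\text{codomain})$. A distinguished square is a finite vertical composite of elements of $\mathbf Q$; length-1 distinguished squares are the elements of $\mathbf Q$. $\mathcal C$ is a contextual category if moreover: there is a unique object $1_{\mathcal C}$ of length $0$, and it is terminal; every element of $\mathbf Q$ is a pullback; $\mathbf Q$ contains the identity square of every $\mathbf p_a$ and is closed under horizontal composition; for every $a$ with $\ell(a)\ge 1$ and $f:b\to\partial a$ there is a unique element of $\mathbf Q$ with right side $\mathbf p_a$ and bottom $f$ (hence any display map has a unique distinguished pullback along any map into its codomain). A morphism (contextual functor) is a functor strictly preserving $\ell,\partial,\mathbf p$ and sending $\mathbf Q$ into $\mathbf Q$.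 Gap maps. In a contextual category, let $S$ be a commutative square with top $f':b'\to b$, bottom $f:a'\to a$, left side $b'\twoheadrightarrow a'$ and right side $p:b\twoheadrightarrow a$ display maps. Let $c$ be the top-left corner of the distinguished square with right side $p$ and bottom $f$. The induced map $b'\to c$ is the gap map of $S$; $S$ is a relative length-1 display map if its gap map is a length-1 display map. Bimorphisms. A bimorphism from $(\mathcal A,\mathcal B)$ to a contextual category $\mathcal C$ is a functor $H:|\mathcal A|\times|\mathcal B|\to|\mathcal C|$ such that: (i) for each $b$, $H(-,b)$ preserves display maps (not necessarily their lengths) and sends length-0 objects to $1_{\mathcal C}$, and it is constant at $1_{\mathcal C}$ if $\ell(b)=0$; (ii) for $a,b$ of length $\ge1$ the square with top $H(id_a,\mathbf p_b):H(a,b)\to H(a,\partial b)$, bottom $H(id_{\partial a},\mathbf p_b)$ and vertical sides $H(\mathbf p_a,id)$ is a relative length-1 display map; write $\mathrm{gap}_H(a,b)$ for its gap map, whose codomain is thus a pullback $H(\partial a,b)\times_{H(\partial a,\partial b)}H(a,\partial b)$; (iii) for $b$ of length $\ge1$ and a square in $\mathbf Q$ of $\mathcal A$ with top $f':a_1\to a_2$, the square with sides $\mathrm{gap}_H(a_1,b)$, $\mathrm{gap}_H(a_2,b)$, top $H(f',id_b)$ and bottom the induced map is distinguished; (iv) for $a$ of length $\ge1$ and a square in $\mathbf Q$ of $\mathcal B$ with top $f':b_1\to b_2$, the square with sides $\mathrm{gap}_H(a,b_1)$, $\mathrm{gap}_H(a,b_2)$, top $H(id_a,f')$ and bottom the induced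 map is distinguished. Tensor product. $\otimes_{\mathcal A,\mathcal B}:\mathcal A\times\mathcal B\to\mathcal A\otimes\mathcal B$ is a chosen universal bimorphism to a small contextual category (it exists): every bimorphism from $(\mathcal A,\mathcal B)$ to a small contextual category factors through it by a unique contextual functor. Symmetry. Let $\sigma:|\mathcal A|\times|\mathcal B|\to|\mathcal B|\times|\mathcal A|$ be the swap. For each bimorphism $F:\mathcal B\times\mathcal A\to\mathcal C$ there is a unique pair $(F',\phi)$ with $F':\mathcal A\times\mathcal B\to\mathcal C$ a bimorphism and $\phi:F'\Rightarrow F\circ\sigma$ a natural isomorphism such that, for all $a,b$ of length $\ge 1$, the square with top $\phi_{a,b}:F'(a,b)\to F(b,a)$, vertical sides $\mathrm{gap}_{F'}(a,b)$ and $\mathrm{gap}_F(b,a)$, and bottom the map of pullbacks induced by $\phi$, is distinguished; moreover $F\mapsto F'$ is a bijection natural in $\mathcal C$. $\beta_{\mathcal A,\mathcal B}:\mathcal A\otimes\mathcal B\to\mathcal B\otimes\mathcal A$ is the unique contextual functor such that $\beta_{\mathcal A,\mathcal B}\circ\otimes_{\mathcal A,\mathcal B}=F'$ for $F=\otimes_{\mathcal B,\mathcal A}$; it is an isomorphism. *)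

theory Defs
  imports Main "HOL-Library.FuncSet"
begin

section \<open>Categories, functors and commutative squares\<close>

text \<open>Composition is written in application order: cmp C g f is g after f.\<close>

record ('o, 'm) cat =
  Obj :: "'o set"
  Arr :: "'m set"
  src :: "'m \<Rightarrow> 'o"
  tgt :: "'m \<Rightarrow> 'o"
  idn :: "'o \<Rightarrow> 'm"
  cmp :: "'m \<Rightarrow> 'm \<Rightarrow> 'm"

definition hom :: "('o, 'm, 'z) cat_scheme \<Rightarrow> 'o \<Rightarrow> 'o \<Rightarrow> 'm set" where
  "hom C a b = {f \<in> Arr C. src C f = a \<and> tgt C f = b}"

locale category =
  fixes C :: "('o, 'm, 'z) cat_scheme"
  assumes src_in: "f \<in> Arr C \<Longrightarrow> src C f \<in> Obj C"
    and tgt_in: "f \<in> Arr C \<Longrightarrow> tgt C f \<in> Obj C"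
    and idn_hom: "a \<in> Obj C \<Longrightarrow> idn C a \<in> hom C a a"
    and cmp_hom: "\<lbrakk>f \<in> hom C a b; g \<in> hom C b c\<rbrakk> \<Longrightarrow> cmp C g f \<in> hom C a c"
    and cmp_idn_right: "f \<in> Arr C \<Longrightarrow> cmp C f (idn C (src C f)) = f"
    and cmp_idn_left: "f \<in> Arr C \<Longrightarrow> cmp C (idn C (tgt C f)) f = f"
    and cmp_assoc: "\<lbrakk>f \<in> hom C a b; g \<in> hom C b c; h \<in> hom C c d\<rbrakk>
      \<Longrightarrow> cmp C h (cmp C g f) = cmp C (cmp C h g) f"

definition cat_prod ::
    "('o, 'm, 'y) cat_scheme \<Rightarrow> ('p, 'n, 'z) cat_scheme \<Rightarrow> ('o \<times> 'p, 'm \<times> 'n) cat" where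
  "cat_prod A B =
    \<lparr>Obj = Obj A \<times> Obj B,
     Arr = Arr A \<times> Arr B,
     src = (\<lambda>(f, g). (src A f, src B g)),
     tgt = (\<lambda>(f, g). (tgt A f, tgt B g)),
     idn = (\<lambda>(a, b). (idn A a, idn B b)),
     cmp = (\<lambda>(f', g') (f, g). (cmp A f' f, cmp B g' g))\<rparr>"

text \<open>Functors are required to be undefined outside their source category, so that
  HOL equality of functors is equality of functors.\<close>

record ('o, 'm, 'p, 'n) fnctr =
  ob :: "'o \<Rightarrow> 'p"
  ar :: "'m \<Rightarrow> 'n"

definition is_functor ::
    "('o, 'm, 'y) cat_scheme \<Rightarrow> ('p, 'n, 'z) cat_scheme \<Rightarrow> ('o, 'm, 'p, 'n) fnctr \<Rightarrow> bool" where
  "is_functor D C F \<longleftrightarrow>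
     ob F \<in> Obj D \<rightarrow>\<^sub>E Obj C \<and>
     ar F \<in> Arr D \<rightarrow>\<^sub>E Arr C \<and>
     (\<forall>f \<in> Arr D. src C (ar F f) = ob F (src D f) \<and> tgt C (ar F f) = ob F (tgt D f)) \<and>
     (\<forall>a \<in> Obj D. ar F (idn D a) = idn C (ob F a)) \<and>
     (\<forall>f \<in> Arr D. \<forall>g \<in> Arr D. tgt D f = src D g \<longrightarrow>
        ar F (cmp D g f) = cmp C (ar F g) (ar F f))"

definition id_functor :: "('o, 'm, 'z) cat_scheme \<Rightarrow> ('o, 'm, 'o, 'm) fnctr" where
  "id_functor D = \<lparr>ob = (\<lambda>a \<in> Obj D. a), ar = (\<lambda>f \<in> Arr D. f)\<rparr>"

definition functor_comp ::
    "('o, 'm, 'z) cat_scheme \<Rightarrow> ('p, 'n, 'q, 'l) fnctr \<Rightarrow> ('o, 'm, 'p, 'n) fnctr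
      \<Rightarrow> ('o, 'm, 'q, 'l) fnctr" where
  "functor_comp D G F =
     \<lparr>ob = compose (Obj D) (ob G) (ob F), ar = compose (Arr D) (ar G) (ar F)\<rparr>"

definition swap_functor ::
    "('o, 'm, 'y) cat_scheme \<Rightarrow> ('p, 'n, 'z) cat_scheme
      \<Rightarrow> ('o \<times> 'p, 'm \<times> 'n, 'p \<times> 'o, 'n \<times> 'm) fnctr" where
  "swap_functor A B =
     \<lparr>ob = (\<lambda>(a, b) \<in> Obj A \<times> Obj B. (b, a)), ar = (\<lambda>(f, g) \<in> Arr A \<times> Arr B. (g, f))\<rparr>"

definition is_iso :: "('o, 'm, 'z) cat_scheme \<Rightarrow> 'm \<Rightarrow> bool" where
  "is_iso C f \<longleftrightarrow> f \<in> Arr C \<and>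
     (\<exists>g \<in> hom C (tgt C f) (src C f).
        cmp C g f = idn C (src C f) \<and> cmp C f g = idn C (tgt C f))"

definition natural_iso ::
    "('o, 'm, 'y) cat_scheme \<Rightarrow> ('p, 'n, 'z) cat_scheme \<Rightarrow> ('o, 'm, 'p, 'n) fnctr
      \<Rightarrow> ('o, 'm, 'p, 'n) fnctr \<Rightarrow> ('o \<Rightarrow> 'n) \<Rightarrow> bool" where
  "natural_iso D C F G \<phi> \<longleftrightarrow>
     (\<forall>a \<in> Obj D. \<phi> a \<in> hom C (ob F a) (ob G a) \<and> is_iso C (\<phi> a)) \<and>
     (\<forall>f \<in> Arr D. cmp C (\<phi> (tgt D f)) (ar F f) = cmp C (ar G f) (\<phi> (src D f)))"

datatype 'm square =
  Square (sq_top: 'm) (sq_bot: 'm) (sq_left: 'm) (sq_right: 'm)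

definition comm_square :: "('o, 'm, 'z) cat_scheme \<Rightarrow> 'm square \<Rightarrow> bool" where
  "comm_square C S \<longleftrightarrow>
     {sq_top S, sq_bot S, sq_left S, sq_right S} \<subseteq> Arr C \<and>
     src C (sq_top S) = src C (sq_left S) \<and> tgt C (sq_top S) = src C (sq_right S) \<and>
     src C (sq_bot S) = tgt C (sq_left S) \<and> tgt C (sq_bot S) = tgt C (sq_right S) \<and>
     cmp C (sq_right S) (sq_top S) = cmp C (sq_bot S) (sq_left S)"

definition is_pullback :: "('o, 'm, 'z) cat_scheme \<Rightarrow> 'm square \<Rightarrow> bool" where
  "is_pullback C S \<longleftrightarrow> comm_square C S \<and>
     (\<forall>x \<in> Obj C. \<forall>u \<in> hom C x (src C (sq_right S)). \<forall>v \<in> hom C x (src C (sq_bot S)).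
        cmp C (sq_right S) u = cmp C (sq_bot S) v \<longrightarrow>
        (\<exists>!w. w \<in> hom C x (src C (sq_left S)) \<and>
              cmp C (sq_top S) w = u \<and> cmp C (sq_left S) w = v))"

definition flip_square :: "'m square \<Rightarrow> 'm square" where
  "flip_square S = Square (sq_left S) (sq_right S) (sq_top S) (sq_bot S)"

text \<open>The map between the top-left corners of S and S' induced, S' being a pullback,
  by the maps x between the top-right corners and y between the bottom-left corners.\<close>

definition corner_map :: "('o, 'm, 'z) cat_scheme \<Rightarrow> 'm square \<Rightarrow> 'm square \<Rightarrow> 'm \<Rightarrow> 'm \<Rightarrow> 'm" where
  "corner_map C S S' x y =
     (THE u. u \<in> hom C (src C (sq_left S)) (src C (sq_left S')) \<and>
             cmp C (sq_top S') u = cmp C x (sq_top S) \<and>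
             cmp C (sq_left S') u = cmp C y (sq_left S))"


section \<open>Contextual categories\<close>

record ('o, 'm) ctx_cat = "('o, 'm) cat" +
  len :: "'o \<Rightarrow> nat"
  parent :: "'o \<Rightarrow> 'o"
  proj :: "'o \<Rightarrow> 'm"
  squares :: "'m square set"

locale precontextual_category = category C
  for C :: "('o, 'm, 'z) ctx_cat_scheme" +
  assumes parent_in: "a \<in> Obj C \<Longrightarrow> parent C a \<in> Obj C"
    and len_parent: "\<lbrakk>a \<in> Obj C; len C a \<ge> 1\<rbrakk> \<Longrightarrow> len C (parent C a) = len C a - 1"
    and parent_len_0: "\<lbrakk>a \<in> Obj C; len C a = 0\<rbrakk> \<Longrightarrow> parent C a = a"
    and proj_hom: "\<lbrakk>a \<in> Obj C; len C a \<ge> 1\<rbrakk> \<Longrightarrow> proj C a \<in> hom C a (parent C a)"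
    and squares_comm: "S \<in> squares C \<Longrightarrow> comm_square C S"
    and squares_left: "S \<in> squares C \<Longrightarrow> \<exists>a \<in> Obj C. len C a \<ge> 1 \<and> sq_left S = proj C a"
    and squares_right: "S \<in> squares C \<Longrightarrow> \<exists>b \<in> Obj C. len C b \<ge> 1 \<and> sq_right S = proj C b"

locale contextual_category = precontextual_category C
  for C :: "('o, 'm, 'z) ctx_cat_scheme" +
  assumes unique_len_0: "\<exists>!a. a \<in> Obj C \<and> len C a = 0"
    and len_0_terminal: "\<lbrakk>a \<in> Obj C; len C a = 0; b \<in> Obj C\<rbrakk> \<Longrightarrow> \<exists>!f. f \<in> hom C b a"
    and squares_pullback: "S \<in> squares C \<Longrightarrow> is_pullback C S"
    and squares_identity: "\<lbrakk>a \<in> Obj C; len C a \<ge> 1\<rbrakk>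
      \<Longrightarrow> Square (idn C a) (idn C (parent C a)) (proj C a) (proj C a) \<in> squares C"
    and squares_horizontal: "\<lbrakk>S \<in> squares C; S' \<in> squares C; sq_right S = sq_left S'\<rbrakk>
      \<Longrightarrow> Square (cmp C (sq_top S') (sq_top S)) (cmp C (sq_bot S') (sq_bot S))
                 (sq_left S) (sq_right S') \<in> squares C"
    and squares_lift: "\<lbrakk>a \<in> Obj C; len C a \<ge> 1; f \<in> Arr C; tgt C f = parent C a\<rbrakk>
      \<Longrightarrow> \<exists>!S. S \<in> squares C \<and> sq_right S = proj C a \<and> sq_bot S = f"

definition unit_obj :: "('o, 'm, 'z) ctx_cat_scheme \<Rightarrow> 'o" where
  "unit_obj C = (THE a. a \<in> Obj C \<and> len C a = 0)"

inductive display_map :: "('o, 'm, 'z) ctx_cat_scheme \<Rightarrow> 'm \<Rightarrow> bool"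
  for C :: "('o, 'm, 'z) ctx_cat_scheme" where
  display_idn: "a \<in> Obj C \<Longrightarrow> display_map C (idn C a)"
| display_step: "\<lbrakk>a \<in> Obj C; len C a \<ge> 1; display_map C d; src C d = parent C a\<rbrakk>
    \<Longrightarrow> display_map C (cmp C d (proj C a))"

definition display_length :: "('o, 'm, 'z) ctx_cat_scheme \<Rightarrow> 'm \<Rightarrow> nat" where
  "display_length C d = len C (src C d) - len C (tgt C d)"

text \<open>The empty vertical composite is allowed: it is the square with identity sides, so
  that display maps of length 0 have distinguished pullbacks too.\<close>

inductive distinguished :: "('o, 'm, 'z) ctx_cat_scheme \<Rightarrow> 'm square \<Rightarrow> bool"
  for C :: "('o, 'm, 'z) ctx_cat_scheme" where
  distinguished_idn: "f \<in> Arr C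
    \<Longrightarrow> distinguished C (Square f f (idn C (src C f)) (idn C (tgt C f)))"
| distinguished_step: "\<lbrakk>S \<in> squares C; distinguished C S'; sq_top S' = sq_bot S\<rbrakk>
    \<Longrightarrow> distinguished C (Square (sq_top S) (sq_bot S')
          (cmp C (sq_left S') (sq_left S)) (cmp C (sq_right S') (sq_right S)))"

definition contextual_functor ::
    "('o, 'm, 'y) ctx_cat_scheme \<Rightarrow> ('p, 'n, 'z) ctx_cat_scheme
      \<Rightarrow> ('o, 'm, 'p, 'n) fnctr \<Rightarrow> bool" where
  "contextual_functor C D F \<longleftrightarrow> is_functor C D F \<and>
     (\<forall>a \<in> Obj C. len D (ob F a) = len C a \<and> parent D (ob F a) = ob F (parent C a)) \<and>
     (\<forall>a \<in> Obj C. len C a \<ge> 1 \<longrightarrow> proj D (ob F a) = ar F (proj C a)) \<and>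
     map_square (ar F) ` squares C \<subseteq> squares D"


section \<open>Gap maps\<close>

definition dist_pullback :: "('o, 'm, 'z) ctx_cat_scheme \<Rightarrow> 'm \<Rightarrow> 'm \<Rightarrow> 'm square" where
  "dist_pullback C p f = (THE D. distinguished C D \<and> sq_right D = p \<and> sq_bot D = f)"

definition gap_map :: "('o, 'm, 'z) ctx_cat_scheme \<Rightarrow> 'm square \<Rightarrow> 'm" where
  "gap_map C S =
     (let D = dist_pullback C (sq_right S) (sq_bot S) in
      THE g. g \<in> hom C (src C (sq_left S)) (src C (sq_left D)) \<and>
             cmp C (sq_top D) g = sq_top S \<and> cmp C (sq_left D) g = sq_left S)"

definition relative_length_1_display :: "('o, 'm, 'z) ctx_cat_scheme \<Rightarrow> 'm square \<Rightarrow> bool" where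
  "relative_length_1_display C S \<longleftrightarrow>
     comm_square C S \<and> display_map C (sq_left S) \<and> display_map C (sq_right S) \<and>
     display_map C (gap_map C S) \<and> display_length C (gap_map C S) = 1"


section \<open>Bimorphisms and the tensor product\<close>

text \<open>For objects a of A and b of B of positive length, the square of condition (ii):
  horizontal maps come from the projection of b, vertical maps from that of a.\<close>

definition bi_square ::
    "('o, 'm, 'x) ctx_cat_scheme \<Rightarrow> ('p, 'n, 'y) ctx_cat_scheme
      \<Rightarrow> ('o \<times> 'p, 'm \<times> 'n, 'q, 'l) fnctr \<Rightarrow> 'o \<Rightarrow> 'p \<Rightarrow> 'l square" where
  "bi_square A B H a b = Square
     (ar H (idn A a, proj B b))
     (ar H (idn A (parent A a), proj B b))
     (ar H (proj A a, idn B b))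
     (ar H (proj A a, idn B (parent B b)))"

definition bi_pullback ::
    "('o, 'm, 'x) ctx_cat_scheme \<Rightarrow> ('p, 'n, 'y) ctx_cat_scheme \<Rightarrow> ('q, 'l, 'z) ctx_cat_scheme
      \<Rightarrow> ('o \<times> 'p, 'm \<times> 'n, 'q, 'l) fnctr \<Rightarrow> 'o \<Rightarrow> 'p \<Rightarrow> 'l square" where
  "bi_pullback A B C H a b =
     dist_pullback C (sq_right (bi_square A B H a b)) (sq_bot (bi_square A B H a b))"

definition bi_gap ::
    "('o, 'm, 'x) ctx_cat_scheme \<Rightarrow> ('p, 'n, 'y) ctx_cat_scheme \<Rightarrow> ('q, 'l, 'z) ctx_cat_scheme
      \<Rightarrow> ('o \<times> 'p, 'm \<times> 'n, 'q, 'l) fnctr \<Rightarrow> 'o \<Rightarrow> 'p \<Rightarrow> 'l" where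
  "bi_gap A B C H a b = gap_map C (bi_square A B H a b)"

definition bimorphism ::
    "('o, 'm, 'x) ctx_cat_scheme \<Rightarrow> ('p, 'n, 'y) ctx_cat_scheme \<Rightarrow> ('q, 'l, 'z) ctx_cat_scheme
      \<Rightarrow> ('o \<times> 'p, 'm \<times> 'n, 'q, 'l) fnctr \<Rightarrow> bool" where
  "bimorphism A B C H \<longleftrightarrow>
     is_functor (cat_prod A B) C H \<and>
     \<comment> \<open>(i)\<close>
     (\<forall>b \<in> Obj B. \<forall>d. display_map A d \<longrightarrow> display_map C (ar H (d, idn B b))) \<and>
     (\<forall>a \<in> Obj A. \<forall>b \<in> Obj B. len A a = 0 \<longrightarrow> ob H (a, b) = unit_obj C) \<and>
     (\<forall>b \<in> Obj B. len B b = 0 \<longrightarrow>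
        (\<forall>a \<in> Obj A. ob H (a, b) = unit_obj C) \<and>
        (\<forall>f \<in> Arr A. ar H (f, idn B b) = idn C (unit_obj C))) \<and>
     \<comment> \<open>(ii)\<close>
     (\<forall>a \<in> Obj A. \<forall>b \<in> Obj B. len A a \<ge> 1 \<longrightarrow> len B b \<ge> 1 \<longrightarrow>
        relative_length_1_display C (bi_square A B H a b)) \<and>
     \<comment> \<open>(iii)\<close>
     (\<forall>b \<in> Obj B. \<forall>S \<in> squares A. len B b \<ge> 1 \<longrightarrow>
        (let f' = sq_top S; f = sq_bot S; a1 = src A f'; a2 = tgt A f' in
         distinguished C (Square
           (ar H (f', idn B b))
           (corner_map C (bi_pullback A B C H a1 b) (bi_pullback A B C H a2 b)
              (ar H (f', idn B (parent B b))) (ar H (f, idn B b)))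
           (bi_gap A B C H a1 b)
           (bi_gap A B C H a2 b)))) \<and>
     \<comment> \<open>(iv)\<close>
     (\<forall>a \<in> Obj A. \<forall>S \<in> squares B. len A a \<ge> 1 \<longrightarrow>
        (let f' = sq_top S; f = sq_bot S; b1 = src B f'; b2 = tgt B f' in
         distinguished C (Square
           (ar H (idn A a, f'))
           (corner_map C (bi_pullback A B C H a b1) (bi_pullback A B C H a b2)
              (ar H (idn A a, f)) (ar H (idn A (parent A a), f')))
           (bi_gap A B C H a b1)
           (bi_gap A B C H a b2))))"

text \<open>The types 'q and 'l play the role of the universe of small sets: a contextual
  category is small if its objects and arrows are elements of these types.\<close>

definition tensor_product ::
    "('o, 'm) ctx_cat \<Rightarrow> ('p, 'n) ctx_cat \<Rightarrow> ('q, 'l) ctx_cat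
      \<Rightarrow> ('o \<times> 'p, 'm \<times> 'n, 'q, 'l) fnctr \<Rightarrow> bool" where
  "tensor_product A B T t \<longleftrightarrow>
     contextual_category T \<and> bimorphism A B T t \<and>
     (\<forall>(C :: ('q, 'l) ctx_cat) H. contextual_category C \<longrightarrow> bimorphism A B C H \<longrightarrow>
        (\<exists>!F. contextual_functor T C F \<and> functor_comp (cat_prod A B) F t = H))"


section \<open>Symmetry\<close>

text \<open>The pullback defining the gap map of F at (b, a) has the roles of its two legs
  exchanged compared with that of F' at (a, b); hence the flip.\<close>

definition bimorphism_swap ::
    "('o, 'm, 'x) ctx_cat_scheme \<Rightarrow> ('p, 'n, 'y) ctx_cat_scheme \<Rightarrow> ('q, 'l, 'z) ctx_cat_scheme
      \<Rightarrow> ('p \<times> 'o, 'n \<times> 'm, 'q, 'l) fnctr \<Rightarrow> ('o \<times> 'p, 'm \<times> 'n, 'q, 'l) fnctr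
      \<Rightarrow> ('o \<times> 'p \<Rightarrow> 'l) \<Rightarrow> bool" where
  "bimorphism_swap A B C F F' \<phi> \<longleftrightarrow>
     bimorphism A B C F' \<and>
     natural_iso (cat_prod A B) C F' (functor_comp (cat_prod A B) F (swap_functor A B)) \<phi> \<and>
     (\<forall>a \<in> Obj A. \<forall>b \<in> Obj B. len A a \<ge> 1 \<longrightarrow> len B b \<ge> 1 \<longrightarrow>
        distinguished C (Square
          (\<phi> (a, b))
          (corner_map C (flip_square (bi_pullback A B C F' a b)) (bi_pullback B A C F b a)
             (\<phi> (parent A a, b)) (\<phi> (a, parent B b)))
          (bi_gap A B C F' a b)
          (bi_gap B A C F b a)))"

text \<open>The contextual functor T \<rightarrow> T', for tensor products t of (A, B) and t' of (B, A).\<close>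

definition symmetry ::
    "('o, 'm) ctx_cat \<Rightarrow> ('p, 'n) ctx_cat
      \<Rightarrow> ('q, 'l) ctx_cat \<Rightarrow> ('o \<times> 'p, 'm \<times> 'n, 'q, 'l) fnctr
      \<Rightarrow> ('q, 'l) ctx_cat \<Rightarrow> ('p \<times> 'o, 'n \<times> 'm, 'q, 'l) fnctr
      \<Rightarrow> ('q, 'l, 'q, 'l) fnctr \<Rightarrow> bool" where
  "symmetry A B T t T' t' \<beta> \<longleftrightarrow>
     contextual_functor T T' \<beta> \<and>
     (\<exists>F' \<phi>. bimorphism_swap A B T' t' F' \<phi> \<and> functor_comp (cat_prod A B) \<beta> t = F')"

end

theory Submission
  imports Defs
begin

text \<open>Composing the isomorphism belonging to \<beta>_BA with the image under \<beta>_BA of the one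
  belonging to \<beta>_AB gives a natural isomorphism \<theta> from \<beta>_BA \<circ> \<beta>_AB \<circ> t to t, where t is the
  universal bimorphism, and horizontal pasting gives a square in Q from one gap map to the other
  with top \<theta>(a, b). By induction on \<ell>(a) + \<ell>(b), \<theta> is the identity: if it is so at
  (\<partial>a, b), (a, \<partial>b) and (\<partial>a, \<partial>b), then the bottom of that square is
  an identity, and uniqueness of distinguished pullbacks makes \<theta>(a, b) an identity too. Hence
  \<beta>_BA \<circ> \<beta>_AB \<circ> t = t, and universality of t concludes.\<close>

section \<open>Pullbacks and gap maps\<close>

context category
begin

lemma cmp_arr:
  assumes "f \<in> Arr C" "g \<in> Arr C" "tgt C f = src C g"
  shows "cmp C g f \<in> Arr C" "src C (cmp C g f) = src C f" "tgt C (cmp C g f) = tgt C g"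
  using cmp_hom[of f "src C f" "tgt C f" g "tgt C g"] assms by (auto simp: hom_def)

lemma idn_arr:
  assumes "a \<in> Obj C"
  shows "idn C a \<in> Arr C" "src C (idn C a) = a" "tgt C (idn C a) = a"
  using idn_hom[OF assms] by (auto simp: hom_def)

lemma cmp_assoc':
  assumes "f \<in> Arr C" "g \<in> Arr C" "h \<in> Arr C" "tgt C f = src C g" "tgt C g = src C h"
  shows "cmp C h (cmp C g f) = cmp C (cmp C h g) f"
  using cmp_assoc[of f "src C f" "tgt C f" g "tgt C g" h "tgt C h"] assms by (auto simp: hom_def)

lemma comm_square_paste:
  assumes S: "comm_square C S" and S': "comm_square C S'" and eq: "sq_top S' = sq_bot S"
  shows "comm_square C (Square (sq_top S) (sq_bot S')
          (cmp C (sq_left S') (sq_left S)) (cmp C (sq_right S') (sq_right S)))"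
proof -
  have "cmp C (cmp C (sq_right S') (sq_right S)) (sq_top S)
      = cmp C (sq_right S') (cmp C (sq_bot S) (sq_left S))"
    using S S' eq cmp_assoc'[of "sq_top S" "sq_right S" "sq_right S'"]
    by (simp add: comm_square_def)
  also have "\<dots> = cmp C (cmp C (sq_right S') (sq_top S')) (sq_left S)"
    using S S' eq cmp_assoc'[of "sq_left S" "sq_bot S" "sq_right S'"]
    by (simp add: comm_square_def)
  also have "\<dots> = cmp C (sq_bot S') (cmp C (sq_left S') (sq_left S))"
    using S S' eq by (auto simp: comm_square_def intro!: cmp_assoc'[symmetric])
  finally show ?thesis
    using S S' eq by (auto simp: comm_square_def cmp_arr)
qed

text \<open>Two successive factorizations: the lower square \<open>S'\<close> first yields a map
  \<open>w'\<close> into its corner, and \<open>w'\<close> then serves as left leg of a cone over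
  the upper square \<open>S\<close>. This is why distinguished squares, being vertical composites,
  are pullbacks.\<close>

lemma is_pullback_paste:
  assumes S: "is_pullback C S" and S': "is_pullback C S'" and eq: "sq_top S' = sq_bot S"
  shows "is_pullback C (Square (sq_top S) (sq_bot S')
          (cmp C (sq_left S') (sq_left S)) (cmp C (sq_right S') (sq_right S)))"
proof -
  have c: "comm_square C S" "comm_square C S'" using S S' by (auto simp: is_pullback_def)
  note c1 = c(1)[unfolded comm_square_def] and c2 = c(2)[unfolded comm_square_def]
  have "\<exists>!w. w \<in> hom C x (src C (sq_left S)) \<and> cmp C (sq_top S) w = u
            \<and> cmp C (cmp C (sq_left S') (sq_left S)) w = v"
    if x: "x \<in> Obj C" and u: "u \<in> hom C x (src C (sq_right S))"
      and v: "v \<in> hom C x (src C (sq_bot S'))"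
      and uv: "cmp C (cmp C (sq_right S') (sq_right S)) u = cmp C (sq_bot S') v" for x u v
  proof -
    have ru: "cmp C (sq_right S) u \<in> hom C x (src C (sq_right S'))"
      using u c1 c2 eq by (auto simp: hom_def cmp_arr)
    have "cmp C (sq_right S') (cmp C (sq_right S) u) = cmp C (sq_bot S') v"
      using uv u c1 c2 eq by (simp add: hom_def cmp_assoc')
    with S' x ru v have "\<exists>!w. w \<in> hom C x (src C (sq_left S')) \<and>
        cmp C (sq_top S') w = cmp C (sq_right S) u \<and> cmp C (sq_left S') w = v"
      unfolding is_pullback_def by blast
    then obtain w' where w': "w' \<in> hom C x (src C (sq_left S'))"
        "cmp C (sq_top S') w' = cmp C (sq_right S) u" "cmp C (sq_left S') w' = v"
      and w'_unique: "\<And>w. w \<in> hom C x (src C (sq_left S')) \<Longrightarrow>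
        cmp C (sq_top S') w = cmp C (sq_right S) u \<Longrightarrow> cmp C (sq_left S') w = v \<Longrightarrow> w = w'"
      by blast
    have "w' \<in> hom C x (src C (sq_bot S))" using w'(1) c1 c2 eq by auto
    moreover have "cmp C (sq_right S) u = cmp C (sq_bot S) w'" using w'(2) eq by simp
    ultimately have "\<exists>!w. w \<in> hom C x (src C (sq_left S)) \<and>
        cmp C (sq_top S) w = u \<and> cmp C (sq_left S) w = w'"
      using S x u unfolding is_pullback_def by blast
    \<comment> \<open>This equivalence carries unique existence from the cone over \<open>S\<close>
      to the cone over the composite. Its backward direction needs the uniqueness of
      \<open>w'\<close>, hence the check that \<open>cmp C (sq_left S) w\<close> has the right top
      leg.\<close>
    moreover have "cmp C (sq_left S) w = w' \<longleftrightarrow> cmp C (cmp C (sq_left S') (sq_left S)) w = v"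
      if w: "w \<in> hom C x (src C (sq_left S))" and t: "cmp C (sq_top S) w = u" for w
    proof -
      have a: "cmp C (cmp C (sq_left S') (sq_left S)) w = cmp C (sq_left S') (cmp C (sq_left S) w)"
        using w c1 c2 eq by (auto simp: hom_def intro!: cmp_assoc'[symmetric])
      have "cmp C (sq_top S') (cmp C (sq_left S) w) = cmp C (cmp C (sq_bot S) (sq_left S)) w"
        using w c1 c2 eq by (auto simp: hom_def intro!: cmp_assoc')
      also have "\<dots> = cmp C (cmp C (sq_right S) (sq_top S)) w" using c1 by simp
      also have "\<dots> = cmp C (sq_right S) u"
        using w c1 t cmp_assoc'[of w "sq_top S" "sq_right S"] by (simp add: hom_def)
      finally have b: "cmp C (sq_top S') (cmp C (sq_left S) w) = cmp C (sq_right S) u" .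
      have "cmp C (sq_left S) w \<in> hom C x (src C (sq_left S'))"
        using w c1 c2 eq by (auto simp: hom_def cmp_arr)
      then show ?thesis using a b w' w'_unique by metis
    qed
    ultimately show ?thesis by blast
  qed
  then show ?thesis
    using comm_square_paste[OF c eq] c1 c2 eq
    by (simp add: is_pullback_def cmp_arr)
qed

text \<open>The universal property speaks of compatible pairs of maps; the pair used here consists
  of the two composites with \<open>w'\<close>, which is compatible because the square
  commutes.\<close>

lemma is_pullback_unique:
  assumes "is_pullback C S" "w \<in> hom C x (src C (sq_left S))" "w' \<in> hom C x (src C (sq_left S))"
    and eq: "cmp C (sq_top S) w = cmp C (sq_top S) w'" "cmp C (sq_left S) w = cmp C (sq_left S) w'"
  shows "w = w'"
proof -
  have c: "comm_square C S" using assms(1) by (simp add: is_pullback_def)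
  have w': "w' \<in> Arr C" "src C w' = x" "tgt C w' = src C (sq_left S)"
    using assms(3) by (auto simp: hom_def)
  have "cmp C (sq_right S) (cmp C (sq_top S) w') = cmp C (sq_bot S) (cmp C (sq_left S) w')"
    using c w' cmp_assoc'[of w' "sq_top S" "sq_right S"] cmp_assoc'[of w' "sq_left S" "sq_bot S"]
    by (simp add: comm_square_def)
  moreover have "x \<in> Obj C" "cmp C (sq_top S) w' \<in> hom C x (src C (sq_right S))"
    "cmp C (sq_left S) w' \<in> hom C x (src C (sq_bot S))"
    using c w' src_in[of w'] by (simp_all add: comm_square_def hom_def cmp_arr)
  ultimately have "\<exists>!v. v \<in> hom C x (src C (sq_left S)) \<and>
      cmp C (sq_top S) v = cmp C (sq_top S) w' \<and> cmp C (sq_left S) v = cmp C (sq_left S) w'"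
    using assms(1) unfolding is_pullback_def by blast
  then show ?thesis using assms(2-) by blast
qed

lemma is_pullback_idn:
  assumes "f \<in> Arr C"
  shows "is_pullback C (Square f f (idn C (src C f)) (idn C (tgt C f)))"
  using assms
  by (auto simp: is_pullback_def comm_square_def idn_arr src_in tgt_in cmp_idn_left cmp_idn_right
      hom_def) (metis cmp_idn_left)+

text \<open>Hypothesis \<open>xy\<close> makes the two composites a cone over \<open>S'\<close>, so
  the definite description in \<open>corner_map\<close> denotes a unique map.\<close>

lemma corner_map_props:
  assumes S: "comm_square C S" and S': "is_pullback C S'"
    and x: "x \<in> hom C (tgt C (sq_top S)) (src C (sq_right S'))"
    and y: "y \<in> hom C (tgt C (sq_left S)) (src C (sq_bot S'))"
    and xy: "cmp C (sq_right S') (cmp C x (sq_top S)) = cmp C (sq_bot S') (cmp C y (sq_left S))"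
  shows "corner_map C S S' x y \<in> hom C (src C (sq_left S)) (src C (sq_left S'))"
    and "cmp C (sq_top S') (corner_map C S S' x y) = cmp C x (sq_top S)"
    and "cmp C (sq_left S') (corner_map C S S' x y) = cmp C y (sq_left S)"
proof -
  have "\<exists>!u. u \<in> hom C (src C (sq_left S)) (src C (sq_left S')) \<and>
             cmp C (sq_top S') u = cmp C x (sq_top S) \<and>
             cmp C (sq_left S') u = cmp C y (sq_left S)"
    using S'[unfolded is_pullback_def, THEN conjunct2, rule_format,
        of "src C (sq_left S)" "cmp C x (sq_top S)" "cmp C y (sq_left S)"] S x y xy
    by (auto simp: comm_square_def hom_def cmp_arr src_in)
  from theI'[OF this]
  show "corner_map C S S' x y \<in> hom C (src C (sq_left S)) (src C (sq_left S'))"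
    and "cmp C (sq_top S') (corner_map C S S' x y) = cmp C x (sq_top S)"
    and "cmp C (sq_left S') (corner_map C S S' x y) = cmp C y (sq_left S)"
    by (auto simp: corner_map_def)
qed

end

section \<open>Display maps, distinguished squares and gap maps in a contextual category\<close>

context contextual_category
begin

lemma proj_arr:
  assumes "a \<in> Obj C" "len C a \<ge> 1"
  shows "proj C a \<in> Arr C" "src C (proj C a) = a" "tgt C (proj C a) = parent C a"
  using proj_hom[OF assms] by (auto simp: hom_def)

lemma display_map_arr:
  "display_map C d \<Longrightarrow> d \<in> Arr C \<and> len C (tgt C d) \<le> len C (src C d)"
proof (induction rule: display_map.induct)
  case (display_step a d)
  then have "src C (cmp C d (proj C a)) = a" "tgt C (cmp C d (proj C a)) = tgt C d"
    "cmp C d (proj C a) \<in> Arr C" "len C (parent C a) \<le> len C a"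
    using len_parent[of a] by (simp_all add: cmp_arr proj_arr)
  then show ?case using display_step by simp
qed (simp add: idn_arr)

text \<open>The cases are phrased through the domain and codomain of \<open>d\<close>, and the
  strict drop in length in the second one excludes the first. Two display maps with the same
  endpoints therefore fall into the same case.\<close>

lemma display_map_cases:
  assumes "display_map C d"
  obtains (idn) "src C d \<in> Obj C" "d = idn C (src C d)" "tgt C d = src C d"
  | (step) e where "src C d \<in> Obj C" "len C (src C d) \<ge> 1" "display_map C e"
      "src C e = parent C (src C d)" "tgt C e = tgt C d" "d = cmp C e (proj C (src C d))"
      "len C (tgt C d) < len C (src C d)"
  using assms
proof cases
  case (display_idn a)
  then show ?thesis using that(1) by (simp add: idn_arr)
next
  case (display_step a e)
  have e: "e \<in> Arr C" "len C (tgt C e) \<le> len C (src C e)"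
    using display_map_arr[OF display_step(4)] by auto
  have d: "src C d = a" "tgt C d = tgt C e"
    unfolding display_step(1) using e display_step(2,3,5) by (simp_all add: cmp_arr proj_arr)
  have "len C (parent C a) < len C a" using len_parent display_step(2,3) by simp
  then show ?thesis using that(2)[of e] d e display_step by simp
qed

text \<open>A display map is a composite of projections, each determined by its domain, so the number of
  factors is read off the lengths of its domain and codomain.\<close>

lemma display_map_unique:
  assumes "display_map C d" "display_map C d'" "src C d = src C d'" "tgt C d = tgt C d'"
  shows "d = d'"
  using assms
proof (induction "len C (src C d)" arbitrary: d d' rule: less_induct)
  case less
  note hyps = less.prems
  from hyps(1) show ?case
  proof (cases rule: display_map_cases)
    case d: idn
    from hyps(2) show ?thesis
      by (cases rule: display_map_cases) (use d hyps in auto)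
  next
    case d: (step e)
    from hyps(2) show ?thesis
    proof (cases rule: display_map_cases)
      case idn
      then show ?thesis using d hyps by auto
    next
      case d': (step e')
      have "len C (src C e) < len C (src C d)" using len_parent d(1,2,4) by simp
      then have "e = e'"
        by (rule less.hyps) (use d d' hyps in auto)
      then show ?thesis using d(6) d'(6) hyps(3) by simp
    qed
  qed
qed

text \<open>After one projection is split off, the remaining display map has domain and codomain of
  equal length. A nonempty one would lower the length, so it is an identity.\<close>

lemma display_length_1:
  assumes "display_map C d" "display_length C d = 1"
  shows "src C d \<in> Obj C" "len C (src C d) \<ge> 1" "d = proj C (src C d)"
proof -
  show s: "src C d \<in> Obj C" "len C (src C d) \<ge> 1"
    using assms display_map_arr[OF assms(1)] src_in by (auto simp: display_length_def)
  from assms(1) show "d = proj C (src C d)"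
  proof (cases rule: display_map_cases)
    case idn
    then show ?thesis using assms by (simp add: display_length_def)
  next
    case (step e)
    have "len C (tgt C e) = len C (src C e)"
      using step assms(2) len_parent[of "src C d"] by (simp add: display_length_def)
    with step(3) have "e = idn C (src C e)"
      by (cases rule: display_map_cases) auto
    then show ?thesis
      using step cmp_idn_left[of "proj C (src C d)"] by (simp add: proj_arr)
  qed
qed

lemma distinguished_is_pullback: "distinguished C S \<Longrightarrow> is_pullback C S"
proof (induction rule: distinguished.induct)
  case (distinguished_idn f)
  then show ?case by (rule is_pullback_idn)
next
  case (distinguished_step S S')
  then show ?case using is_pullback_paste squares_pullback by blast
qed

lemma distinguished_comm_square: "distinguished C S \<Longrightarrow> comm_square C S"
  using distinguished_is_pullback by (auto simp: is_pullback_def)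

lemma squares_sides:
  assumes "S \<in> squares C"
  shows "src C (sq_right S) \<in> Obj C" "len C (src C (sq_right S)) \<ge> 1"
    "sq_right S = proj C (src C (sq_right S))"
    "tgt C (sq_right S) = parent C (src C (sq_right S))"
  using squares_right[OF assms] by (auto simp: proj_arr)

lemma distinguished_display_right: "distinguished C S \<Longrightarrow> display_map C (sq_right S)"
proof (induction rule: distinguished.induct)
  case (distinguished_idn f)
  then show ?case by (auto intro: display_map.intros tgt_in)
next
  case (distinguished_step S S')
  have "display_map C (cmp C (sq_right S') (proj C (src C (sq_right S))))"
    using distinguished_step squares_sides[of S] squares_comm[of S] distinguished_comm_square[of S']
    by (intro display_map.intros) (auto simp: comm_square_def)
  then show ?case using squares_sides[OF distinguished_step.hyps(1)] by simp
qed

text \<open>The endpoints of the right side decide which case applies, so two distinguished squares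
  with the same right side can be decomposed in parallel.\<close>

lemma distinguished_cases:
  assumes "distinguished C D"
  obtains (idn) "sq_bot D \<in> Arr C" "src C (sq_right D) = tgt C (sq_right D)"
      "D = Square (sq_bot D) (sq_bot D) (idn C (src C (sq_bot D))) (idn C (tgt C (sq_bot D)))"
  | (step) S S' where "S \<in> squares C" "distinguished C S'" "sq_top S' = sq_bot S"
      "D = Square (sq_top S) (sq_bot S')
          (cmp C (sq_left S') (sq_left S)) (cmp C (sq_right S') (sq_right S))"
      "src C (sq_right S) = src C (sq_right D)" "tgt C (sq_right S') = tgt C (sq_right D)"
      "src C (sq_right S') = parent C (src C (sq_right D))"
      "len C (tgt C (sq_right D)) < len C (src C (sq_right D))"
  using assms
proof cases
  case (distinguished_idn f)
  then show ?thesis using that(1) by (simp add: idn_arr tgt_in)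
next
  case (distinguished_step S S')
  have c: "comm_square C S" "comm_square C S'"
    using distinguished_step squares_comm distinguished_comm_square by auto
  have "src C (sq_right S') = parent C (src C (sq_right S))"
    using c distinguished_step(4) squares_sides[OF distinguished_step(2)]
    by (simp add: comm_square_def)
  moreover have "len C (tgt C (sq_right S')) \<le> len C (src C (sq_right S'))"
    using distinguished_step(3) distinguished_display_right display_map_arr by blast
  moreover have "len C (parent C (src C (sq_right S))) < len C (src C (sq_right S))"
    using len_parent squares_sides(1,2)[OF distinguished_step(2)] by simp
  moreover have "src C (sq_right D) = src C (sq_right S)" "tgt C (sq_right D) = tgt C (sq_right S')"
    using c distinguished_step(1,4) by (simp_all add: comm_square_def cmp_arr)
  ultimately show ?thesis using that(2)[OF distinguished_step(2,3,4,1)] by simp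
qed

text \<open>Induction on the length of the domain of the right side. The lower parts agree by
  induction, their common top is the bottom of both upper squares, and \<open>squares_lift\<close>
  then identifies the upper squares.\<close>

lemma distinguished_unique:
  assumes "distinguished C D" "distinguished C D'" "sq_right D = sq_right D'" "sq_bot D = sq_bot D'"
  shows "D = D'"
  using assms
proof (induction "len C (src C (sq_right D))" arbitrary: D D' rule: less_induct)
  case less
  note prems = less.prems
  from prems(1) show ?case
  proof (cases rule: distinguished_cases)
    case D: idn
    from prems(2) show ?thesis
    proof (cases rule: distinguished_cases)
      case idn
      then show ?thesis using D(3) prems(4) by simp
    next
      case step
      then show ?thesis using D(2) prems(3) by simp
    qed
  next
    case D: (step S S')
    from prems(2) show ?thesis
    proof (cases rule: distinguished_cases)
      case idn
      then show ?thesis using D(8) prems(3) by simp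
    next
      case D': (step R R')
      have right: "sq_right S = sq_right R"
        using squares_sides(3) D(1,5) D'(1,5) prems(3) by metis
      \<comment> \<open>This comes from uniqueness of display maps with given endpoints, not from
        cancelling the first projection.\<close>
      have right': "sq_right S' = sq_right R'"
        using D(2,6,7) D'(2,6,7) prems(3)
        by (intro display_map_unique distinguished_display_right) auto
      have "sq_bot S' = sq_bot R'"
        using arg_cong[OF D(4), of sq_bot] arg_cong[OF D'(4), of sq_bot] prems(4) by simp
      moreover have "len C (src C (sq_right S')) < len C (src C (sq_right D))"
        using D(5,7) squares_sides(1,2)[OF D(1)] len_parent by simp
      ultimately have eq: "S' = R'" using less.hyps D(2) D'(2) right' by blast
      then have bot: "sq_bot S = sq_bot R" using D(3) D'(3) by simp
      have "comm_square C S" using D(1) squares_comm by blast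
      then have "\<exists>!U. U \<in> squares C \<and> sq_right U = sq_right S \<and> sq_bot U = sq_bot S"
        using squares_lift[of "src C (sq_right S)" "sq_bot S"] squares_sides[OF D(1)]
        by (simp add: comm_square_def)
      then have "S = R" using D(1) D'(1) right bot by metis
      then show ?thesis using D(4) D'(4) eq by simp
    qed
  qed
qed

text \<open>The pullback is built upwards: the top of the square over \<open>d\<close> ends at
  \<open>parent C a\<close>, so the square over \<open>proj C a\<close> can be lifted along
  it.\<close>

lemma distinguished_exists:
  assumes "display_map C d" "f \<in> Arr C" "tgt C f = tgt C d"
  shows "\<exists>D. distinguished C D \<and> sq_right D = d \<and> sq_bot D = f"
  using assms
proof (induction rule: display_map.induct)
  case (display_idn a)
  then show ?case using distinguished_idn[of f C] by (auto simp: idn_arr)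
next
  case (display_step a d)
  have "tgt C f = tgt C d"
    using display_step display_map_arr[of d] by (auto simp: cmp_arr proj_arr)
  then obtain D where D: "distinguished C D" "sq_right D = d" "sq_bot D = f"
    using display_step by blast
  have c: "comm_square C D" using D distinguished_comm_square by blast
  then have "sq_top D \<in> Arr C" "tgt C (sq_top D) = parent C a"
    using D display_step by (auto simp: comm_square_def)
  then obtain S where "S \<in> squares C" "sq_right S = proj C a" "sq_bot S = sq_top D"
    using squares_lift display_step by metis
  then show ?case using D distinguished_step[of S C D] by force
qed

lemma dist_pullback_eq:
  assumes "distinguished C D" "sq_right D = p" "sq_bot D = f"
  shows "dist_pullback C p f = D"
  unfolding dist_pullback_def using assms distinguished_unique by (intro the_equality) auto

lemma dist_pullback_props:
  assumes "display_map C d" "f \<in> Arr C" "tgt C f = tgt C d"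
  shows "distinguished C (dist_pullback C d f)" "sq_right (dist_pullback C d f) = d"
    "sq_bot (dist_pullback C d f) = f"
  using distinguished_exists[OF assms] dist_pullback_eq by metis+

text \<open>Horizontal pasting is an axiom for \<open>squares C\<close> only, whereas the symmetry
  data are given as distinguished squares; this lemma bridges the two. The lift \<open>R\<close> in
  \<open>squares C\<close> with the same right side and bottom is itself distinguished, hence equal
  to \<open>S\<close>.\<close>

lemma distinguished_length_1:
  assumes "distinguished C S" "display_length C (sq_right S) = 1"
  shows "S \<in> squares C"
proof -
  have c: "comm_square C S" using assms distinguished_comm_square by blast
  note p = display_length_1[OF distinguished_display_right[OF assms(1)] assms(2)]
  define a where "a = src C (sq_right S)"
  have a: "a \<in> Obj C" "len C a \<ge> 1" "sq_right S = proj C a" using p by (auto simp: a_def)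
  obtain R where R: "R \<in> squares C" "sq_right R = sq_right S" "sq_bot R = sq_bot S"
    using squares_lift[of a "sq_bot S"] a c by (auto simp: comm_square_def proj_arr)
  have cR: "comm_square C R" using R squares_comm by blast
  \<comment> \<open>The inductive definition of \<open>distinguished\<close> ends in an identity
    square, so \<open>R\<close> is exhibited as itself pasted onto \<open>I\<close>.\<close>
  define I where "I = Square (sq_bot R) (sq_bot R) (idn C (src C (sq_bot R))) (idn C (tgt C (sq_bot R)))"
  have "distinguished C I" unfolding I_def
    using cR by (intro distinguished_idn) (auto simp: comm_square_def)
  then have "distinguished C (Square (sq_top R) (sq_bot I)
     (cmp C (sq_left I) (sq_left R)) (cmp C (sq_right I) (sq_right R)))"
    using R by (intro distinguished_step) (auto simp: I_def)
  moreover have "cmp C (sq_left I) (sq_left R) = sq_left R" "cmp C (sq_right I) (sq_right R) = sq_right R"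
    using cR cmp_idn_left[of "sq_left R"] cmp_idn_left[of "sq_right R"]
    by (auto simp: comm_square_def I_def)
  ultimately have "distinguished C R" by (simp add: I_def)
  then show ?thesis using distinguished_unique[of R S] R assms by simp
qed

text \<open>The last clause is the characterization by which a candidate is recognized as the gap
  map, for instance the image of a gap map under a contextual functor.\<close>

lemma gap_map_props:
  assumes "comm_square C S" "display_map C (sq_right S)"
  defines "D \<equiv> dist_pullback C (sq_right S) (sq_bot S)"
  shows "gap_map C S \<in> hom C (src C (sq_left S)) (src C (sq_left D))"
    "cmp C (sq_top D) (gap_map C S) = sq_top S"
    "cmp C (sq_left D) (gap_map C S) = sq_left S"
    "\<And>g. g \<in> hom C (src C (sq_left S)) (src C (sq_left D)) \<Longrightarrow>
      cmp C (sq_top D) g = sq_top S \<Longrightarrow> cmp C (sq_left D) g = sq_left S \<Longrightarrow> g = gap_map C S"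
proof -
  have D: "is_pullback C D" "sq_right D = sq_right S" "sq_bot D = sq_bot S"
    using dist_pullback_props[of "sq_right S" "sq_bot S"] assms distinguished_is_pullback
    by (auto simp: comm_square_def)
  have *: "\<exists>!g. g \<in> hom C (src C (sq_left S)) (src C (sq_left D)) \<and>
             cmp C (sq_top D) g = sq_top S \<and> cmp C (sq_left D) g = sq_left S"
    using D(1)[unfolded is_pullback_def, THEN conjunct2, rule_format,
        of "src C (sq_left S)" "sq_top S" "sq_left S"] assms(1) D
    by (auto simp: comm_square_def hom_def src_in)
  have g: "gap_map C S = (THE g. g \<in> hom C (src C (sq_left S)) (src C (sq_left D)) \<and>
             cmp C (sq_top D) g = sq_top S \<and> cmp C (sq_left D) g = sq_left S)"
    by (simp add: gap_map_def D_def Let_def)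
  from theI'[OF *] show "gap_map C S \<in> hom C (src C (sq_left S)) (src C (sq_left D))"
    "cmp C (sq_top D) (gap_map C S) = sq_top S"
    "cmp C (sq_left D) (gap_map C S) = sq_left S" by (auto simp: g)
  with * show "\<And>g. g \<in> hom C (src C (sq_left S)) (src C (sq_left D)) \<Longrightarrow>
      cmp C (sq_top D) g = sq_top S \<Longrightarrow> cmp C (sq_left D) g = sq_left S \<Longrightarrow> g = gap_map C S"
    by blast
qed

end

section \<open>Contextual functors\<close>

lemma functor_arr:
  assumes "is_functor C D F" "f \<in> Arr C"
  shows "ar F f \<in> Arr D" "src D (ar F f) = ob F (src C f)" "tgt D (ar F f) = ob F (tgt C f)"
  using assms by (auto simp: is_functor_def)

lemma functor_ob: "is_functor C D F \<Longrightarrow> a \<in> Obj C \<Longrightarrow> ob F a \<in> Obj D"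
  by (auto simp: is_functor_def)

lemma functor_idn: "is_functor C D F \<Longrightarrow> a \<in> Obj C \<Longrightarrow> ar F (idn C a) = idn D (ob F a)"
  by (auto simp: is_functor_def)

lemma functor_cmp:
  "is_functor C D F \<Longrightarrow> f \<in> Arr C \<Longrightarrow> g \<in> Arr C \<Longrightarrow> tgt C f = src C g \<Longrightarrow>
    ar F (cmp C g f) = cmp D (ar F g) (ar F f)"
  by (auto simp: is_functor_def)

lemma functor_hom: "is_functor C D F \<Longrightarrow> f \<in> hom C a b \<Longrightarrow> ar F f \<in> hom D (ob F a) (ob F b)"
  by (auto simp: hom_def functor_arr)

lemma functor_comm_square:
  assumes "is_functor C D F" "comm_square C S"
  shows "comm_square D (map_square (ar F) S)"
proof -
  have "cmp D (ar F (sq_right S)) (ar F (sq_top S)) = cmp D (ar F (sq_bot S)) (ar F (sq_left S))"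
    using assms functor_cmp[OF assms(1), of "sq_top S" "sq_right S"]
      functor_cmp[OF assms(1), of "sq_left S" "sq_bot S"] by (simp add: comm_square_def)
  then show ?thesis
    using assms by (simp add: comm_square_def square.map_sel functor_arr)
qed

lemma contextual_functor_functor: "contextual_functor C D F \<Longrightarrow> is_functor C D F"
  by (simp add: contextual_functor_def)

lemma contextual_functor_id:
  assumes "contextual_category C"
  shows "contextual_functor C C (id_functor C)"
proof -
  interpret contextual_category C by fact
  \<comment> \<open>The identity functor is undefined outside \<open>Arr C\<close>, so the sides of
    \<open>S\<close> have to be known to be arrows.\<close>
  have "map_square (\<lambda>f\<in>Arr C. f) S = S" if "S \<in> squares C" for S
    using squares_comm[OF that] by (cases S) (simp add: comm_square_def)
  then show ?thesis
    by (auto simp: contextual_functor_def is_functor_def id_functor_def src_in tgt_in idn_arr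
        parent_in proj_arr cmp_arr)
qed

lemma contextual_functor_comp:
  assumes C: "contextual_category C" and F: "contextual_functor C D F"
    and G: "contextual_functor D E G"
  shows "contextual_functor C E (functor_comp C G F)"
proof -
  interpret contextual_category C by fact
  note f = contextual_functor_functor[OF F] contextual_functor_functor[OF G]
  have sq: "map_square (ar (functor_comp C G F)) S = map_square (ar G) (map_square (ar F) S)"
    if "S \<in> squares C" for S
    using squares_comm[OF that] by (cases S) (simp add: comm_square_def functor_comp_def compose_def)
  have "is_functor C E (functor_comp C G F)"
    unfolding is_functor_def functor_comp_def compose_def
    using functor_arr[OF f(1)] functor_arr[OF f(2)] functor_ob[OF f(1)] functor_ob[OF f(2)]
      functor_idn[OF f(1)] functor_idn[OF f(2)] functor_cmp[OF f(1)] functor_cmp[OF f(2)]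
    by (auto simp: src_in tgt_in idn_arr cmp_arr)
  moreover have "map_square (ar (functor_comp C G F)) ` squares C \<subseteq> squares E"
    using F G sq by (force simp: contextual_functor_def)
  ultimately show ?thesis
    using F G functor_ob[OF f(1)]
    by (auto simp: contextual_functor_def functor_comp_def compose_def parent_in proj_arr)
qed

lemma contextual_functor_distinguished:
  assumes C: "contextual_category C" and D: "contextual_category D"
    and F: "contextual_functor C D F" and S: "distinguished C S"
  shows "distinguished D (map_square (ar F) S)"
proof -
  interpret C: contextual_category C by fact
  note f = contextual_functor_functor[OF F]
  from S show ?thesis
  proof (induction rule: distinguished.induct)
    case (distinguished_idn f')
    then show ?case
      using distinguished.distinguished_idn[of "ar F f'" D] functor_arr[OF f] functor_idn[OF f]
      by (simp add: C.src_in C.tgt_in)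
  next
    case (distinguished_step S S')
    have c: "comm_square C S" "comm_square C S'"
      using distinguished_step C.squares_comm C.distinguished_comm_square by auto
    have "map_square (ar F) S \<in> squares D"
      using F distinguished_step by (auto simp: contextual_functor_def)
    from distinguished.distinguished_step[OF this distinguished_step.IH]
    show ?case
      using distinguished_step(3) c functor_cmp[OF f, of "sq_left S" "sq_left S'"]
        functor_cmp[OF f, of "sq_right S" "sq_right S'"]
      by (simp add: square.map_sel comm_square_def)
  qed
qed

text \<open>The image square is distinguished over the image of the cospan, and uniqueness of such
  squares gives an equality, not just an isomorphism.\<close>

lemma contextual_functor_dist_pullback:
  assumes C: "contextual_category C" and D: "contextual_category D"
    and F: "contextual_functor C D F" and p: "display_map C p" "f \<in> Arr C" "tgt C f = tgt C p"
  shows "dist_pullback D (ar F p) (ar F f) = map_square (ar F) (dist_pullback C p f)"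
proof -
  interpret C: contextual_category C by fact
  interpret D: contextual_category D by fact
  note P = C.dist_pullback_props[OF p]
  show ?thesis
    using P by (intro D.dist_pullback_eq contextual_functor_distinguished[OF C D F])
      (simp_all add: square.map_sel)
qed

text \<open>By the previous lemma the image of \<open>P\<close> is the pullback that defines the gap
  map on the left. The image of the old gap map satisfies the two equations that determine the new
  one.\<close>

lemma contextual_functor_gap_map:
  assumes C: "contextual_category C" and D: "contextual_category D"
    and F: "contextual_functor C D F" and S: "comm_square C S" "display_map C (sq_right S)"
  shows "gap_map D (map_square (ar F) S) = ar F (gap_map C S)"
proof -
  interpret C: contextual_category C by fact
  interpret D: contextual_category D by fact
  note f = contextual_functor_functor[OF F]
  define P where "P = dist_pullback C (sq_right S) (sq_bot S)"
  have a: "sq_bot S \<in> Arr C" "tgt C (sq_bot S) = tgt C (sq_right S)"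
    using S by (auto simp: comm_square_def)
  have P: "distinguished C P" "sq_right P = sq_right S" "sq_bot P = sq_bot S"
    using C.dist_pullback_props[OF S(2) a] by (auto simp: P_def)
  have cP: "comm_square C P" using P C.distinguished_comm_square by blast
  have P': "dist_pullback D (sq_right (map_square (ar F) S)) (sq_bot (map_square (ar F) S))
      = map_square (ar F) P"
    using contextual_functor_dist_pullback[OF C D F S(2) a] by (simp add: square.map_sel P_def)
  have disp: "display_map D (sq_right (map_square (ar F) S))"
    using D.distinguished_display_right[OF contextual_functor_distinguished[OF C D F P(1)]] P(2)
    by (simp add: square.map_sel)
  note g = C.gap_map_props(1-3)[OF S, folded P_def]
  show ?thesis
  proof (rule D.gap_map_props(4)[OF functor_comm_square[OF f S(1)] disp, symmetric])
    show "ar F (gap_map C S) \<in> hom D (src D (sq_left (map_square (ar F) S)))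
      (src D (sq_left (dist_pullback D (sq_right (map_square (ar F) S)) (sq_bot (map_square (ar F) S)))))"
      using functor_hom[OF f g(1)] S cP unfolding P'
      by (simp add: square.map_sel comm_square_def functor_arr[OF f])
    show "cmp D (sq_top (dist_pullback D (sq_right (map_square (ar F) S)) (sq_bot (map_square (ar F) S))))
       (ar F (gap_map C S)) = sq_top (map_square (ar F) S)"
      using g cP functor_cmp[OF f, of "gap_map C S" "sq_top P"] unfolding P'
      by (simp add: square.map_sel comm_square_def hom_def)
    show "cmp D (sq_left (dist_pullback D (sq_right (map_square (ar F) S)) (sq_bot (map_square (ar F) S))))
       (ar F (gap_map C S)) = sq_left (map_square (ar F) S)"
      using g cP functor_cmp[OF f, of "gap_map C S" "sq_left P"] unfolding P'
      by (simp add: square.map_sel comm_square_def hom_def)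
  qed
qed

section \<open>Bimorphisms and their symmetry\<close>

lemma cat_prod_simps [simp]:
  "Obj (cat_prod A B) = Obj A \<times> Obj B"
  "Arr (cat_prod A B) = Arr A \<times> Arr B"
  "src (cat_prod A B) (f, g) = (src A f, src B g)"
  "tgt (cat_prod A B) (f, g) = (tgt A f, tgt B g)"
  "idn (cat_prod A B) (a, b) = (idn A a, idn B b)"
  by (simp_all add: cat_prod_def)

lemma functor_comp_prod:
  "a \<in> Obj A \<Longrightarrow> b \<in> Obj B \<Longrightarrow> ob (functor_comp (cat_prod A B) G F) (a, b) = ob G (ob F (a, b))"
  "f \<in> Arr A \<Longrightarrow> g \<in> Arr B \<Longrightarrow> ar (functor_comp (cat_prod A B) G F) (f, g) = ar G (ar F (f, g))"
  by (simp_all add: functor_comp_def compose_def)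

section \<open>The pullbacks and gap maps of one bimorphism, and their images under contextual
  functors\<close>

locale bimorphism_locale =
  A: contextual_category A + B: contextual_category B + C: contextual_category C
  for A :: "('o, 'm, 'x) ctx_cat_scheme" and B :: "('p, 'n, 'y) ctx_cat_scheme"
    and C :: "('q, 'l, 'z) ctx_cat_scheme" +
  fixes H :: "('o \<times> 'p, 'm \<times> 'n, 'q, 'l) fnctr"
  assumes bim: "bimorphism A B C H"
begin

lemma bim_functor: "is_functor (cat_prod A B) C H"
  using bim by (simp add: bimorphism_def)

lemma ob_in: "a \<in> Obj A \<Longrightarrow> b \<in> Obj B \<Longrightarrow> ob H (a, b) \<in> Obj C"
  using functor_ob[OF bim_functor] by simp

lemma ar_arr:
  assumes "f \<in> Arr A" "g \<in> Arr B"
  shows "ar H (f, g) \<in> Arr C" "src C (ar H (f, g)) = ob H (src A f, src B g)"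
    "tgt C (ar H (f, g)) = ob H (tgt A f, tgt B g)"
  using functor_arr[OF bim_functor, of "(f, g)"] assms by simp_all

lemma ob_unit:
  "a \<in> Obj A \<Longrightarrow> b \<in> Obj B \<Longrightarrow> len A a = 0 \<or> len B b = 0 \<Longrightarrow> ob H (a, b) = unit_obj C"
  using bim by (auto simp: bimorphism_def)

context
  fixes a b
  assumes ab: "a \<in> Obj A" "b \<in> Obj B" "len A a \<ge> 1" "len B b \<ge> 1"
begin

lemma bi_square_props:
  "comm_square C (bi_square A B H a b)" "display_map C (sq_right (bi_square A B H a b))"
  "display_map C (bi_gap A B C H a b)" "display_length C (bi_gap A B C H a b) = 1"
  using bim ab by (auto simp: bimorphism_def relative_length_1_display_def bi_gap_def)

lemma bi_pullback_props:
  "distinguished C (bi_pullback A B C H a b)"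
  "sq_right (bi_pullback A B C H a b) = ar H (proj A a, idn B (parent B b))"
  "sq_bot (bi_pullback A B C H a b) = ar H (idn A (parent A a), proj B b)"
  using C.dist_pullback_props[OF bi_square_props(2), of "sq_bot (bi_square A B H a b)"]
    bi_square_props(1)
  by (auto simp: comm_square_def bi_pullback_def) (simp_all add: bi_square_def)

text \<open>A display map of length 1 is the projection of its domain, so the gap map is determined
  by the object \<open>ob H (a, b)\<close> alone.\<close>

lemma bi_gap_props:
  "bi_gap A B C H a b \<in> hom C (ob H (a, b)) (src C (sq_left (bi_pullback A B C H a b)))"
  "bi_gap A B C H a b = proj C (ob H (a, b))"
  "len C (ob H (a, b)) \<ge> 1"
proof -
  have "src C (sq_left (bi_square A B H a b)) = ob H (a, b)"
    using ab ar_arr by (simp add: bi_square_def A.proj_arr B.idn_arr)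
  then show g: "bi_gap A B C H a b \<in> hom C (ob H (a, b)) (src C (sq_left (bi_pullback A B C H a b)))"
    using C.gap_map_props(1)[OF bi_square_props(1,2)] by (simp add: bi_gap_def bi_pullback_def)
  then show "bi_gap A B C H a b = proj C (ob H (a, b))" "len C (ob H (a, b)) \<ge> 1"
    using C.display_length_1[OF bi_square_props(3,4)] by (simp_all add: hom_def)
qed

lemma bi_square_comp:
  "bi_square A B (functor_comp (cat_prod A B) F H) a b = map_square (ar F) (bi_square A B H a b)"
  using ab
  by (simp add: bi_square_def functor_comp_prod A.idn_arr B.idn_arr A.proj_arr B.proj_arr
      A.parent_in B.parent_in)

text \<open>Later applied to \<open>\<beta>'\<close>, where it identifies the pullbacks of the
  composites with \<open>\<beta>'\<close> strictly with images of pullbacks already at hand.\<close>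

lemma bi_pullback_comp:
  assumes D: "contextual_category D" and F: "contextual_functor C D F"
  shows "bi_pullback A B D (functor_comp (cat_prod A B) F H) a b
    = map_square (ar F) (bi_pullback A B C H a b)"
  using contextual_functor_dist_pullback[OF C.contextual_category_axioms D F bi_square_props(2),
      of "sq_bot (bi_square A B H a b)"] bi_square_props(1)
  unfolding bi_pullback_def bi_square_comp by (simp add: comm_square_def square.map_sel)

lemma bi_gap_comp:
  assumes D: "contextual_category D" and F: "contextual_functor C D F"
  shows "bi_gap A B D (functor_comp (cat_prod A B) F H) a b = ar F (bi_gap A B C H a b)"
  using contextual_functor_gap_map[OF C.contextual_category_axioms D F bi_square_props(1,2)]
  unfolding bi_gap_def bi_square_comp .

end

end

section \<open>A single application of the symmetry: \<open>F\<close> is the given bimorphism and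
  \<open>F'\<close> the derived one\<close>

locale bimorphism_swap_locale =
  F: bimorphism_locale B A C F
  for A :: "('o, 'm, 'x) ctx_cat_scheme" and B :: "('p, 'n, 'y) ctx_cat_scheme"
    and C :: "('q, 'l, 'z) ctx_cat_scheme" and F +
  fixes F' \<phi>
  assumes swap: "bimorphism_swap A B C F F' \<phi>"
begin

sublocale F': bimorphism_locale A B C F'
  by unfold_locales (use swap in \<open>simp add: bimorphism_swap_def\<close>)

lemma iso_hom: "a \<in> Obj A \<Longrightarrow> b \<in> Obj B \<Longrightarrow> \<phi> (a, b) \<in> hom C (ob F' (a, b)) (ob F (b, a))"
  using swap by (auto simp: bimorphism_swap_def natural_iso_def functor_comp_prod swap_functor_def)

lemma natural:
  "f \<in> Arr A \<Longrightarrow> g \<in> Arr B \<Longrightarrow>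
    cmp C (\<phi> (tgt A f, tgt B g)) (ar F' (f, g)) = cmp C (ar F (g, f)) (\<phi> (src A f, src B g))"
  using swap by (force simp: bimorphism_swap_def natural_iso_def functor_comp_prod swap_functor_def)

text \<open>Replaces the definite description in the swap condition by equations for the bottom map
  \<open>u\<close>. The legs of \<open>P'\<close> enter in exchanged order because of the flip. The
  square lies in \<open>squares C\<close> since its right side, a gap map, has length 1.\<close>

lemma gap_square:
  assumes ab: "a \<in> Obj A" "b \<in> Obj B" "len A a \<ge> 1" "len B b \<ge> 1"
  defines "P' \<equiv> bi_pullback A B C F' a b" and "P \<equiv> bi_pullback B A C F b a"
  obtains u where "Square (\<phi> (a, b)) u (bi_gap A B C F' a b) (bi_gap B A C F b a) \<in> squares C"
    "u \<in> hom C (src C (sq_left P')) (src C (sq_left P))"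
    "cmp C (sq_top P) u = cmp C (\<phi> (parent A a, b)) (sq_left P')"
    "cmp C (sq_left P) u = cmp C (\<phi> (a, parent B b)) (sq_top P')"
proof -
  define u where "u = corner_map C (flip_square P') P (\<phi> (parent A a, b)) (\<phi> (a, parent B b))"
  note P' = F'.bi_pullback_props[OF ab, folded P'_def]
  note P = F.bi_pullback_props[OF ab(2,1,4,3), folded P_def]
  have c: "comm_square C P'" "is_pullback C P"
    using P' P F.C.distinguished_comm_square F.C.distinguished_is_pullback by auto
  note cP' = c(1)[unfolded comm_square_def]
  have pa: "parent A a \<in> Obj A" "parent B b \<in> Obj B" using ab F.A.parent_in F.B.parent_in by auto
  note arrs = F.B.idn_arr F.A.idn_arr F.B.proj_arr F.A.proj_arr F'.ar_arr F.ar_arr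
  have cf: "comm_square C (flip_square P')" using cP' by (simp add: comm_square_def flip_square_def)
  have l: "tgt C (sq_left P') = ob F' (parent A a, b)"
    using cP' P' ab pa by (simp add: arrs)
  have t: "tgt C (sq_top P') = ob F' (a, parent B b)"
    using cP' P' ab pa by (simp add: arrs)
  have top: "sq_top P' \<in> Arr C" "tgt C (sq_top P') = src C (sq_right P')"
    using cP' by auto
  \<comment> \<open>Naturality along the two sides of the cospan; both instances end with
    \<open>\<phi>\<close> at the common vertex, the pair of parents.\<close>
  have nat1: "cmp C (ar F (proj B b, idn A (parent A a))) (\<phi> (parent A a, b))
      = cmp C (\<phi> (parent A a, parent B b)) (ar F' (idn A (parent A a), proj B b))"
    using natural[of "idn A (parent A a)" "proj B b"] ab pa by (simp add: arrs)
  have nat2: "cmp C (ar F (idn B (parent B b), proj A a)) (\<phi> (a, parent B b))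
      = cmp C (\<phi> (parent A a, parent B b)) (ar F' (proj A a, idn B (parent B b)))"
    using natural[of "proj A a" "idn B (parent B b)"] ab pa by (simp add: arrs)
  \<comment> \<open>The cone condition for the corner map: \<open>nat1\<close> moves
    \<open>\<phi>\<close> to the common vertex, commutativity of \<open>P'\<close> switches legs,
    and \<open>nat2\<close> moves \<open>\<phi>\<close> back along the other side.\<close>
  have "cmp C (sq_right P) (cmp C (\<phi> (parent A a, b)) (sq_left P'))
      = cmp C (cmp C (ar F (proj B b, idn A (parent A a))) (\<phi> (parent A a, b))) (sq_left P')"
    using iso_hom[of "parent A a" b] ab pa cP' l P
    by (simp add: hom_def arrs F.C.cmp_assoc')
  also have "\<dots> = cmp C (\<phi> (parent A a, parent B b)) (cmp C (sq_bot P') (sq_left P'))"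
    using iso_hom[of "parent A a" "parent B b"] ab pa cP' l P'
    unfolding nat1 by (simp add: hom_def arrs F.C.cmp_assoc')
  also have "\<dots> = cmp C (\<phi> (parent A a, parent B b)) (cmp C (sq_right P') (sq_top P'))"
    using cP' by simp
  also have "\<dots> = cmp C (cmp C (ar F (idn B (parent B b), proj A a)) (\<phi> (a, parent B b))) (sq_top P')"
    using iso_hom[of "parent A a" "parent B b"] ab pa top
      F.C.cmp_assoc'[of "sq_top P'" "sq_right P'" "\<phi> (parent A a, parent B b)"]
    unfolding nat2 P'(2) by (simp add: hom_def arrs)
  also have "\<dots> = cmp C (sq_bot P) (cmp C (\<phi> (a, parent B b)) (sq_top P'))"
    using iso_hom[of a "parent B b"] ab pa cP' t P
    by (simp add: hom_def arrs F.C.cmp_assoc')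
  finally have eq: "cmp C (sq_right P) (cmp C (\<phi> (parent A a, b)) (sq_left P'))
      = cmp C (sq_bot P) (cmp C (\<phi> (a, parent B b)) (sq_top P'))" .
  have x: "\<phi> (parent A a, b) \<in> hom C (tgt C (sq_top (flip_square P'))) (src C (sq_right P))"
    using iso_hom[of "parent A a" b] ab pa l P by (simp add: flip_square_def arrs)
  have y: "\<phi> (a, parent B b) \<in> hom C (tgt C (sq_left (flip_square P'))) (src C (sq_bot P))"
    using iso_hom[of a "parent B b"] ab pa t P by (simp add: flip_square_def arrs)
  have u: "u \<in> hom C (src C (sq_left (flip_square P'))) (src C (sq_left P))"
    "cmp C (sq_top P) u = cmp C (\<phi> (parent A a, b)) (sq_top (flip_square P'))"
    "cmp C (sq_left P) u = cmp C (\<phi> (a, parent B b)) (sq_left (flip_square P'))"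
    unfolding u_def
    by (rule F.C.corner_map_props[OF cf c(2) x y]; use eq in \<open>simp add: flip_square_def\<close>)+
  have "distinguished C (Square (\<phi> (a, b)) u (bi_gap A B C F' a b) (bi_gap B A C F b a))"
    using swap ab by (simp add: bimorphism_swap_def u_def P_def P'_def)
  then have "Square (\<phi> (a, b)) u (bi_gap A B C F' a b) (bi_gap B A C F b a) \<in> squares C"
    using F.bi_square_props(4)[OF ab(2,1,4,3)] by (intro F.C.distinguished_length_1) simp_all
  then show thesis
    using that u cP' by (simp add: flip_square_def)
qed

end

text \<open>The core of the argument. In its application \<open>C\<close> and \<open>D\<close> are
  the tensor products of \<open>(A, B)\<close> and \<open>(B, A)\<close>, \<open>F'\<close> is
  \<open>\<beta>\<close> after \<open>t\<close>, and \<open>\<beta>'\<close> is the symmetry in the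
  other direction.\<close>

lemma bimorphism_swap_swap:
  assumes A: "contextual_category A" and B: "contextual_category B"
    and C: "contextual_category C" and D: "contextual_category D"
    and t: "bimorphism A B C t" and t': "bimorphism B A D t'"
    and swap: "bimorphism_swap A B D t' F' \<phi>"
    and \<beta>': "contextual_functor D C \<beta>'"
    and swap': "bimorphism_swap B A C t (functor_comp (cat_prod B A) \<beta>' t') \<psi>"
  shows "functor_comp (cat_prod A B) \<beta>' F' = t"
proof -
  interpret A: contextual_category A by fact
  interpret B: contextual_category B by fact
  interpret C: contextual_category C by fact
  interpret D: contextual_category D by fact
  interpret t: bimorphism_locale A B C t by unfold_locales fact
  interpret t': bimorphism_locale B A D t' by unfold_locales fact
  interpret s: bimorphism_swap_locale A B D t' F' \<phi> by unfold_locales fact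
  interpret s': bimorphism_swap_locale B A C t "functor_comp (cat_prod B A) \<beta>' t'" \<psi>
    by unfold_locales fact
  note f = contextual_functor_functor[OF \<beta>']
  define H where "H = functor_comp (cat_prod A B) \<beta>' F'"
  have ob_H: "ob H (a, b) = ob \<beta>' (ob F' (a, b))" if "a \<in> Obj A" "b \<in> Obj B" for a b
    using that by (simp add: H_def functor_comp_prod)
  have ar_H: "ar H (f, g) = ar \<beta>' (ar F' (f, g))" if "f \<in> Arr A" "g \<in> Arr B" for f g
    using that by (simp add: H_def functor_comp_prod)
  \<comment> \<open>The middle object is \<open>ob \<beta>' (ob t' (b, a))\<close>, so
    \<open>\<theta>\<close> goes from \<open>H\<close> to \<open>t\<close>.\<close>
  define \<theta> where "\<theta> a b = cmp C (\<psi> (b, a)) (ar \<beta>' (\<phi> (a, b)))" for a b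
  have \<phi>: "ar \<beta>' (\<phi> (a, b)) \<in> hom C (ob H (a, b)) (ob \<beta>' (ob t' (b, a)))"
    and \<psi>: "\<psi> (b, a) \<in> hom C (ob \<beta>' (ob t' (b, a))) (ob t (a, b))"
    if "a \<in> Obj A" "b \<in> Obj B" for a b
    using functor_hom[OF f s.iso_hom] s'.iso_hom that by (simp_all add: ob_H functor_comp_prod)
  have \<theta>_hom: "\<theta> a b \<in> hom C (ob H (a, b)) (ob t (a, b))" if "a \<in> Obj A" "b \<in> Obj B" for a b
    using C.cmp_hom[OF \<phi> \<psi>] that by (simp add: \<theta>_def)
  \<comment> \<open>Pasting of the image under \<open>\<beta>'\<close> of the naturality square of
    \<open>\<phi>\<close> (\<open>n1\<close>) with the one of \<open>\<psi>\<close>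
    (\<open>n2\<close>).\<close>
  have \<theta>_natural: "cmp C (\<theta> (tgt A f) (tgt B g)) (ar H (f, g)) = cmp C (ar t (f, g)) (\<theta> (src A f) (src B g))"
    if fg: "f \<in> Arr A" "g \<in> Arr B" for f g
  proof -
    note o = A.src_in[OF fg(1)] A.tgt_in[OF fg(1)] B.src_in[OF fg(2)] B.tgt_in[OF fg(2)]
    note h = \<phi>[OF o(2,4), unfolded hom_def] \<phi>[OF o(1,3), unfolded hom_def]
      \<psi>[OF o(2,4), unfolded hom_def] \<psi>[OF o(1,3), unfolded hom_def]
      s.iso_hom[OF o(2,4), unfolded hom_def] s.iso_hom[OF o(1,3), unfolded hom_def]
    have F': "ar \<beta>' (ar F' (f, g)) \<in> hom C (ob H (src A f, src B g)) (ob H (tgt A f, tgt B g))"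
      using functor_arr[OF f s.F'.ar_arr(1)[OF fg]] s.F'.ar_arr[OF fg] o by (simp add: hom_def ob_H)
    have tg: "ar \<beta>' (ar t' (g, f)) \<in> hom C (ob \<beta>' (ob t' (src B g, src A f))) (ob \<beta>' (ob t' (tgt B g, tgt A f)))"
      using functor_arr[OF f t'.ar_arr(1)[OF fg(2,1)]] t'.ar_arr[OF fg(2,1)] by (simp add: hom_def)
    have tf: "ar t (f, g) \<in> hom C (ob t (src A f, src B g)) (ob t (tgt A f, tgt B g))"
      using t.ar_arr[OF fg] by (simp add: hom_def)
    have "cmp C (ar \<beta>' (\<phi> (tgt A f, tgt B g))) (ar \<beta>' (ar F' (f, g)))
        = ar \<beta>' (cmp D (\<phi> (tgt A f, tgt B g)) (ar F' (f, g)))"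
      using functor_cmp[OF f] h s.F'.ar_arr[OF fg] by simp
    also have "\<dots> = cmp C (ar \<beta>' (ar t' (g, f))) (ar \<beta>' (\<phi> (src A f, src B g)))"
      unfolding s.natural[OF fg] using functor_cmp[OF f] h t'.ar_arr[OF fg(2,1)] by simp
    finally have n1: "cmp C (ar \<beta>' (\<phi> (tgt A f, tgt B g))) (ar \<beta>' (ar F' (f, g))) = \<dots>" .
    have n2: "cmp C (\<psi> (tgt B g, tgt A f)) (ar \<beta>' (ar t' (g, f))) = cmp C (ar t (f, g)) (\<psi> (src B g, src A f))"
      using s'.natural[OF fg(2,1)] fg by (simp add: functor_comp_prod)
    have "cmp C (\<theta> (tgt A f) (tgt B g)) (ar H (f, g))
        = cmp C (\<psi> (tgt B g, tgt A f)) (cmp C (ar \<beta>' (\<phi> (tgt A f, tgt B g))) (ar \<beta>' (ar F' (f, g))))"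
      unfolding \<theta>_def ar_H[OF fg] using C.cmp_assoc[OF F' \<phi>[OF o(2,4)] \<psi>[OF o(2,4)]] by simp
    also have "\<dots> = cmp C (cmp C (\<psi> (tgt B g, tgt A f)) (ar \<beta>' (ar t' (g, f)))) (ar \<beta>' (\<phi> (src A f, src B g)))"
      unfolding n1 using C.cmp_assoc[OF \<phi>[OF o(1,3)] tg \<psi>[OF o(2,4)]] .
    also have "\<dots> = cmp C (ar t (f, g)) (\<theta> (src A f) (src B g))"
      unfolding n2 \<theta>_def using C.cmp_assoc[OF \<phi>[OF o(1,3)] \<psi>[OF o(1,3)] tf] by simp
    finally show ?thesis .
  qed
  \<comment> \<open>An identity has equal source and target, so a component of
    \<open>\<theta>\<close> that is an identity forces equality of objects; naturality then does the
    same for arrows.\<close>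
  have ob_eq: "ob H (a, b) = ob t (a, b)"
    if "a \<in> Obj A" "b \<in> Obj B" "\<theta> a b = idn C (ob t (a, b))" for a b
    using \<theta>_hom[OF that(1,2)] that t.ob_in by (simp add: hom_def C.idn_arr)
  have ar_eq: "ar H (f, g) = ar t (f, g)"
    if fg: "f \<in> Arr A" "g \<in> Arr B" and "\<theta> (src A f) (src B g) = idn C (ob t (src A f, src B g))"
      "\<theta> (tgt A f) (tgt B g) = idn C (ob t (tgt A f, tgt B g))" for f g
  proof -
    have "ar H (f, g) \<in> Arr C" "tgt C (ar H (f, g)) = ob t (tgt A f, tgt B g)"
      using functor_arr[OF f s.F'.ar_arr(1)[OF fg]] s.F'.ar_arr[OF fg] ob_eq[OF _ _ that(4)] fg
        A.tgt_in B.tgt_in by (simp_all add: ar_H ob_H)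
    then show ?thesis
      using \<theta>_natural[OF fg] that C.cmp_idn_left[of "ar H (f, g)"] C.cmp_idn_right[of "ar t (f, g)"]
        t.ar_arr[OF fg] by simp
  qed
  have \<theta>_idn: "\<theta> a b = idn C (ob t (a, b))" if "a \<in> Obj A" "b \<in> Obj B" for a b
    using that
  proof (induction "len A a + len B b" arbitrary: a b rule: less_induct)
    case less
    note ab = less.prems
    show ?case
    proof (cases "len A a = 0 \<or> len B b = 0")
      \<comment> \<open>Both ends are the terminal object, whose only endomorphism is the
        identity.\<close>
      case True
      have "\<exists>!a. a \<in> Obj C \<and> len C a = 0" "\<exists>!a. a \<in> Obj D \<and> len D a = 0"
        using C.unique_len_0 D.unique_len_0 .
      note unit = theI'[OF this(1), folded unit_obj_def] theI'[OF this(2), folded unit_obj_def]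
      have "ob H (a, b) \<in> Obj C \<and> len C (ob H (a, b)) = 0"
        using ob_H[OF ab] s.F'.ob_unit[OF ab True] unit \<beta>' functor_ob[OF f]
        by (simp add: contextual_functor_def)
      then have "ob H (a, b) = unit_obj C" using C.unique_len_0 unit(1) by blast
      moreover have "ob t (a, b) = unit_obj C" using t.ob_unit[OF ab True] .
      ultimately show ?thesis
        using \<theta>_hom[OF ab] C.len_0_terminal[of "unit_obj C" "unit_obj C"] unit
          C.idn_hom[of "unit_obj C"] by metis
    next
      case False
      then have l: "len A a \<ge> 1" "len B b \<ge> 1" by auto
      define a' where "a' = parent A a"
      define b' where "b' = parent B b"
      have p: "a' \<in> Obj A" "b' \<in> Obj B" "len A a' < len A a" "len B b' < len B b"
        using ab l A.parent_in B.parent_in A.len_parent B.len_parent by (simp_all add: a'_def b'_def)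
      have IH: "\<theta> a' b = idn C (ob t (a', b))" "\<theta> a b' = idn C (ob t (a, b'))"
        "\<theta> a' b' = idn C (ob t (a', b'))"
        using less.hyps ab p by simp_all
      \<comment> \<open>The two sides of the cospan of \<open>H\<close> coincide with those of
        \<open>t\<close>; their endpoints are the three pairs covered by \<open>IH\<close>.\<close>
      have legs: "ar H (proj A a, idn B b') = ar t (proj A a, idn B b')"
        "ar H (idn A a', proj B b) = ar t (idn A a', proj B b)"
        using ar_eq IH ab p l by (simp_all add: A.proj_arr B.proj_arr A.idn_arr B.idn_arr a'_def b'_def)
      define P where "P = bi_pullback A B C t a b"
      define P1 where "P1 = bi_pullback A B D F' a b"
      define P2 where "P2 = bi_pullback B A D t' b a"
      have P: "distinguished C P" using t.bi_pullback_props(1)[OF ab l] by (simp add: P_def)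
      have P1: "distinguished D P1" using s.F'.bi_pullback_props(1)[OF ab l] by (simp add: P1_def)
      have P2: "distinguished D P2" using t'.bi_pullback_props(1)[OF ab(2,1) l(2,1)] by (simp add: P2_def)
      have cP: "is_pullback C P" "comm_square C P" "comm_square D P1" "comm_square D P2"
        using P P1 P2 C.distinguished_is_pullback C.distinguished_comm_square D.distinguished_comm_square by auto
      \<comment> \<open>Equal cospans have the same chosen distinguished pullback, so the image of
        \<open>P1\<close> is \<open>P\<close> itself.\<close>
      have "map_square (ar \<beta>') P1 = bi_pullback A B C H a b"
        using s.F'.bi_pullback_comp[OF ab l C \<beta>'] by (simp add: P1_def H_def)
      also have "\<dots> = P"
        using legs by (simp add: P_def bi_pullback_def bi_square_def a'_def b'_def)
      finally have eqP: "map_square (ar \<beta>') P1 = P" .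
      have eqP': "bi_pullback B A C (functor_comp (cat_prod B A) \<beta>' t') b a = map_square (ar \<beta>') P2"
        using t'.bi_pullback_comp[OF ab(2,1) l(2,1) C \<beta>'] by (simp add: P2_def)
      have eqg: "bi_gap B A C (functor_comp (cat_prod B A) \<beta>' t') b a = ar \<beta>' (bi_gap B A D t' b a)"
        using t'.bi_gap_comp[OF ab(2,1) l(2,1) C \<beta>'] .
      obtain u where u: "Square (\<phi> (a, b)) u (bi_gap A B D F' a b) (bi_gap B A D t' b a) \<in> squares D"
        "u \<in> hom D (src D (sq_left P1)) (src D (sq_left P2))"
        "cmp D (sq_top P2) u = cmp D (\<phi> (a', b)) (sq_left P1)"
        "cmp D (sq_left P2) u = cmp D (\<phi> (a, b')) (sq_top P1)"
        using s.gap_square[OF ab l, folded P1_def P2_def a'_def b'_def] by blast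
      \<comment> \<open>For \<open>\<psi>\<close> the given bimorphism is \<open>t\<close> and the
        derived one is \<open>\<beta>'\<close> after \<open>t'\<close>, so the flipped pullback is
        now the image of \<open>P2\<close>.\<close>
      obtain v where v: "Square (\<psi> (b, a)) v (ar \<beta>' (bi_gap B A D t' b a)) (bi_gap A B C t a b) \<in> squares C"
        "v \<in> hom C (src C (sq_left (map_square (ar \<beta>') P2))) (src C (sq_left P))"
        "cmp C (sq_top P) v = cmp C (\<psi> (b', a)) (sq_left (map_square (ar \<beta>') P2))"
        "cmp C (sq_left P) v = cmp C (\<psi> (b, a')) (sq_top (map_square (ar \<beta>') P2))"
        using s'.gap_square[OF ab(2,1) l(2,1), unfolded eqP' eqg, folded P_def a'_def b'_def] by blast
      have "map_square (ar \<beta>') (Square (\<phi> (a, b)) u (bi_gap A B D F' a b) (bi_gap B A D t' b a)) \<in> squares C"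
        using \<beta>' u(1) by (auto simp: contextual_functor_def)
      \<comment> \<open>The two squares fit together because \<open>eqg\<close> has put the shared
        gap map into the form of an image under \<open>\<beta>'\<close>.\<close>
      from C.squares_horizontal[OF this v(1)]
      have sq: "Square (\<theta> a b) (cmp C v (ar \<beta>' u)) (ar \<beta>' (bi_gap A B D F' a b)) (bi_gap A B C t a b) \<in> squares C"
        by (simp add: \<theta>_def)
      have eqP_sides: "sq_top P = ar \<beta>' (sq_top P1)" "sq_left P = ar \<beta>' (sq_left P1)"
        by (simp_all add: eqP[symmetric] square.map_sel)
      have P1_arr: "sq_top P1 \<in> Arr D" "sq_left P1 \<in> Arr D" "src D (sq_top P1) = src D (sq_left P1)"
        "tgt D (sq_top P1) = ob F' (a, b')" "tgt D (sq_left P1) = ob F' (a', b)"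
        using cP(3) s.F'.bi_pullback_props(2,3)[OF ab l, folded P1_def a'_def b'_def] ab p l
          s.F'.ar_arr[of "proj A a" "idn B b'"] s.F'.ar_arr[of "idn A a'" "proj B b"]
        by (simp_all add: comm_square_def A.proj_arr B.proj_arr A.idn_arr B.idn_arr)
      have P2_arr: "sq_top P2 \<in> Arr D" "sq_left P2 \<in> Arr D" "src D (sq_top P2) = src D (sq_left P2)"
        "tgt D (sq_top P2) = ob t' (b, a')" "tgt D (sq_left P2) = ob t' (b', a)"
        using cP(4) t'.bi_pullback_props(2,3)[OF ab(2,1) l(2,1), folded P2_def a'_def b'_def] ab p l
          t'.ar_arr[of "proj B b" "idn A a'"] t'.ar_arr[of "idn B b'" "proj A a"]
        by (simp_all add: comm_square_def A.proj_arr B.proj_arr A.idn_arr B.idn_arr)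
      have \<beta>u: "ar \<beta>' u \<in> hom C (src C (sq_left P)) (src C (sq_left (map_square (ar \<beta>') P2)))"
        using functor_hom[OF f u(2)] P1_arr P2_arr
        by (simp add: eqP_sides square.map_sel functor_arr[OF f])
      \<comment> \<open>The bottom of the pasted square; since the image of \<open>P1\<close> is
        \<open>P\<close>, it is an endomorphism of the corner of \<open>P\<close>, and it will turn
        out to be the identity.\<close>
      define w where "w = cmp C v (ar \<beta>' u)"
      have w: "w \<in> hom C (src C (sq_left P)) (src C (sq_left P))"
        using C.cmp_hom[OF \<beta>u v(2)] by (simp add: w_def)
      \<comment> \<open>Treats both legs of \<open>P\<close> at once. Each flip exchanges top and
        left, so a leg of \<open>P\<close> passes through the opposite leg of \<open>P2\<close> and
        returns to the same leg of \<open>P1\<close>; what remains is \<open>\<theta>\<close> at a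
        smaller pair, an identity by induction.\<close>
      have leg: "cmp C q w = ar \<beta>' q1"
        if q: "q \<in> hom C (src C (sq_left P)) z" and q1: "q1 \<in> hom D (src D (sq_left P1)) (ob F' (c, d))"
          and q2: "q2 \<in> hom D (src D (sq_left P2)) (ob t' (d, c))"
          and cd: "c \<in> Obj A" "d \<in> Obj B" "\<theta> c d = idn C (ob t (c, d))"
          and qv: "cmp C q v = cmp C (\<psi> (d, c)) (ar \<beta>' q2)"
          and q2u: "cmp D q2 u = cmp D (\<phi> (c, d)) q1" for q q1 q2 c d z
      proof -
        note h = functor_hom[OF f q1] functor_hom[OF f q2] functor_hom[OF f u(2)]
        have "cmp C q w = cmp C (cmp C q v) (ar \<beta>' u)"
          unfolding w_def using C.cmp_assoc[OF \<beta>u v(2) q] .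
        also have "\<dots> = cmp C (\<psi> (d, c)) (cmp C (ar \<beta>' q2) (ar \<beta>' u))"
          unfolding qv using C.cmp_assoc[OF h(3,2) \<psi>[OF cd(1,2)]] by simp
        also have "cmp C (ar \<beta>' q2) (ar \<beta>' u) = ar \<beta>' (cmp D q2 u)"
          using functor_cmp[OF f, of u q2] u(2) q2 by (simp add: hom_def)
        also have "\<dots> = cmp C (ar \<beta>' (\<phi> (c, d))) (ar \<beta>' q1)"
          unfolding q2u using functor_cmp[OF f, of q1 "\<phi> (c, d)"] q1 s.iso_hom[OF cd(1,2)]
          by (simp add: hom_def)
        also have "cmp C (\<psi> (d, c)) \<dots> = cmp C (\<theta> c d) (ar \<beta>' q1)"
          unfolding \<theta>_def using C.cmp_assoc[OF h(1)[folded ob_H[OF cd(1,2)]] \<phi>[OF cd(1,2)] \<psi>[OF cd(1,2)]] .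
        also have "\<dots> = ar \<beta>' q1"
          using C.cmp_idn_left[of "ar \<beta>' q1"] h(1) ob_eq[OF cd] ob_H[OF cd(1,2)]
          by (simp add: cd(3) hom_def)
        finally show ?thesis .
      qed
      have P_arr: "sq_top P \<in> hom C (src C (sq_left P)) (src C (sq_right P))"
        "sq_left P \<in> hom C (src C (sq_left P)) (src C (sq_bot P))"
        using cP(2) by (simp_all add: comm_square_def hom_def)
      have "cmp C (sq_top P) w = sq_top P"
        using leg[OF P_arr(1), of "sq_top P1" a b' "sq_left P2"] P1_arr P2_arr ab p IH u(4) v(3)
        by (simp add: hom_def square.map_sel eqP_sides)
      moreover have "cmp C (sq_left P) w = sq_left P"
        using leg[OF P_arr(2), of "sq_left P1" a' b "sq_top P2"] P1_arr P2_arr ab p IH u(3) v(4)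
        by (simp add: hom_def square.map_sel eqP_sides)
      moreover have "src C (sq_left P) \<in> Obj C" using P_arr C.src_in by (auto simp: hom_def)
      \<comment> \<open>\<open>w\<close> and the identity have the same composites with both legs of
        the pullback \<open>P\<close>.\<close>
      ultimately have w_idn: "w = idn C (src C (sq_left P))"
        using C.is_pullback_unique[OF cP(1) w C.idn_hom] P_arr C.cmp_idn_right[of "sq_top P"]
          C.cmp_idn_right[of "sq_left P"] cP(2) by (simp add: hom_def comm_square_def)
      define x where "x = ob t (a, b)"
      note g = t.bi_gap_props[OF ab l, folded x_def P_def]
      have x: "x \<in> Obj C" using t.ob_in[OF ab] by (simp add: x_def)
      have par: "parent C x = src C (sq_left P)"
        using g C.proj_arr[OF x g(3)] by (simp add: hom_def)
      \<comment> \<open>The pasted square and the identity square of \<open>proj C x\<close> share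
        right side and bottom. They are therefore equal, and comparing tops gives the claim.\<close>
      have "\<exists>!S. S \<in> squares C \<and> sq_right S = proj C x \<and> sq_bot S = idn C (parent C x)"
        using x g(3) C.parent_in[OF x] C.idn_arr[of "parent C x"] by (intro C.squares_lift) auto
      moreover have "Square (\<theta> a b) (idn C (parent C x)) (ar \<beta>' (bi_gap A B D F' a b)) (proj C x) \<in> squares C"
        using sq w_idn by (simp add: g(2) par w_def)
      ultimately show ?thesis
        using C.squares_identity[OF x g(3)] unfolding x_def[symmetric]
        by (metis square.inject square.sel(2,4))
    qed
  qed
  \<comment> \<open>Both functors are undefined outside the product category, so agreement on it
    yields equality in HOL.\<close>
  have H: "ob H \<in> extensional (Obj A \<times> Obj B)" "ar H \<in> extensional (Arr A \<times> Arr B)"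
    by (simp_all add: H_def functor_comp_def)
  have "ob H = ob t"
    using H(1) t.bim_functor ob_eq \<theta>_idn
    by (intro extensionalityI[of _ "Obj A \<times> Obj B"]) (auto simp: is_functor_def PiE_def)
  moreover have "ar H = ar t"
    using H(2) t.bim_functor ar_eq \<theta>_idn
    by (intro extensionalityI[of _ "Arr A \<times> Arr B"])
      (auto simp: is_functor_def PiE_def A.src_in A.tgt_in B.src_in B.tgt_in)
  ultimately show ?thesis by (simp add: H_def)
qed

text \<open>Universality of \<open>t\<close> is applied to \<open>t\<close> itself, with
  \<open>T\<close> as target: both \<open>F\<close> and the identity are factorizations of
  \<open>t\<close> through \<open>t\<close>.\<close>

lemma tensor_product_endofunctor:
  fixes T :: "('q, 'l) ctx_cat"
  assumes "tensor_product A B T t" "contextual_functor T T F" "functor_comp (cat_prod A B) F t = t"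
  shows "F = id_functor T"
proof -
  have T: "contextual_category T" "bimorphism A B T t"
    and uniq: "\<exists>!F. contextual_functor T T F \<and> functor_comp (cat_prod A B) F t = t"
    using assms(1) by (auto simp: tensor_product_def)
  have t: "is_functor (cat_prod A B) T t" using T(2) by (simp add: bimorphism_def)
  have "ob (functor_comp (cat_prod A B) (id_functor T) t) = ob t"
    using t by (intro extensionalityI[of _ "Obj A \<times> Obj B"])
      (auto simp: is_functor_def PiE_def functor_comp_def id_functor_def compose_def)
  moreover have "ar (functor_comp (cat_prod A B) (id_functor T) t) = ar t"
    using t by (intro extensionalityI[of _ "Arr A \<times> Arr B"])
      (auto simp: is_functor_def PiE_def functor_comp_def id_functor_def compose_def)
  ultimately have "functor_comp (cat_prod A B) (id_functor T) t = t" by simp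
  then show ?thesis using uniq assms(2,3) contextual_functor_id[OF T(1)] by blast
qed

text \<open>One of the two composites; exchanging \<open>A\<close> and \<open>B\<close> gives the
  other. Applying the symmetry twice fixes \<open>t\<close>, and universality passes from this to
  the composite functor.\<close>

lemma symmetry_symmetry:
  assumes A: "contextual_category A" and B: "contextual_category B"
    and t: "tensor_product A B T t" and t': "tensor_product B A T' t'"
    and \<beta>: "symmetry A B T t T' t' \<beta>" and \<beta>': "symmetry B A T' t' T t \<beta>'"
  shows "functor_comp T \<beta>' \<beta> = id_functor T"
proof (rule tensor_product_endofunctor[OF t])
  have T: "contextual_category T" "contextual_category T'" "bimorphism A B T t" "bimorphism B A T' t'"
    using t t' by (auto simp: tensor_product_def)
  have c: "contextual_functor T T' \<beta>" "contextual_functor T' T \<beta>'"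
    using \<beta> \<beta>' by (auto simp: symmetry_def)
  then show "contextual_functor T T (functor_comp T \<beta>' \<beta>)"
    using contextual_functor_comp[OF T(1)] by blast
  obtain \<phi> \<psi> where
    "bimorphism_swap A B T' t' (functor_comp (cat_prod A B) \<beta> t) \<phi>"
    "bimorphism_swap B A T t (functor_comp (cat_prod B A) \<beta>' t') \<psi>"
    using \<beta> \<beta>' by (auto simp: symmetry_def)
  then have "functor_comp (cat_prod A B) \<beta>' (functor_comp (cat_prod A B) \<beta> t) = t"
    using bimorphism_swap_swap[OF A B T] c(2) by blast
  \<comment> \<open>Composition is restricted to a given domain, so associativity requires that
    \<open>t\<close> takes its values in \<open>T\<close>.\<close>
  moreover have "functor_comp (cat_prod A B) (functor_comp T \<beta>' \<beta>) t
      = functor_comp (cat_prod A B) \<beta>' (functor_comp (cat_prod A B) \<beta> t)"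
  proof -
    have t_fun: "ob t \<in> Obj A \<times> Obj B \<rightarrow> Obj T" "ar t \<in> Arr A \<times> Arr B \<rightarrow> Arr T"
      using T(3) by (simp_all add: bimorphism_def is_functor_def PiE_def)
    show ?thesis
      by (simp add: functor_comp_def compose_assoc[OF t_fun(1)] compose_assoc[OF t_fun(2)])
  qed
  ultimately show "functor_comp (cat_prod A B) (functor_comp T \<beta>' \<beta>) t = t" by simp
qed

theorem proposition7p14:
  fixes A B T_AB T_BA :: "('o, 'm) ctx_cat"
  assumes "contextual_category A"
    and "contextual_category B"
    and "tensor_product A B T_AB t_AB"
    and "tensor_product B A T_BA t_BA"
    and "symmetry A B T_AB t_AB T_BA t_BA \<beta>_AB"
    and "symmetry B A T_BA t_BA T_AB t_AB \<beta>_BA"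
  shows "functor_comp T_AB \<beta>_BA \<beta>_AB = id_functor T_AB \<and>
         functor_comp T_BA \<beta>_AB \<beta>_BA = id_functor T_BA"
  using assms symmetry_symmetry by blast

end
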